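(* Let $\Phi$ be a symbol of the form $\Phi(s)=c_0s+\phi(s)$ (with $c_0$ a non-negative integer and $\phi$ a convergent Dirichlet series) defining the composition-differentiation operator $D_\Phi f=f'\circ\Phi$ on $\mathcal{H}^2$. If there exists $\epsilon>\frac12$ such that $\Phi(\mathbb{C}_0)\subset\mathbb{C}_\epsilon$, then $D_\Phi$ is a Hilbert–Schmidt operator on $\mathcal{H}^2$.
   Context: $\mathbb{C}_\theta=\{s:\Re s>\theta\}$. $\mathcal{H}^2$ is the Hilbert space of Dirichlet series $f(s)=\sum_{n\ge1}a_nn^{-s}$ with $\|f\|_{\mathcal{H}^2}^2=\sum_n|a_n|^2<\infty$; the functions $e_n(s)=n^{-s}$ form an orthonormal basis. *)

theory Defs
  imports "HOL-Analysis.Analysis"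
begin

definition halfplane :: "real \<Rightarrow> complex set" where
  "halfplane \<theta> = {s. Re s > \<theta>}"

text \<open>Elements of H^2 are represented by their coefficient sequences (a_n)_{n>=1};
  the unused index 0 is normalised to 0.\<close>
definition H2 :: "(nat \<Rightarrow> complex) set" where
  "H2 = {a. a 0 = 0 \<and> summable (\<lambda>n. (cmod (a n))\<^sup>2)}"

definition H2_norm :: "(nat \<Rightarrow> complex) \<Rightarrow> real" where
  "H2_norm a = sqrt (\<Sum>n. (cmod (a n))\<^sup>2)"

definition dir_eval :: "(nat \<Rightarrow> complex) \<Rightarrow> complex \<Rightarrow> complex" where
  "dir_eval a s = (\<Sum>n. a n * of_nat n powr (- s))"

definition e_basis :: "nat \<Rightarrow> (nat \<Rightarrow> complex)" where
  "e_basis n = (\<lambda>m. if m = n then 1 else 0)"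

text \<open>D_Phi f is the element g of H^2 whose Dirichlet series represents f' o Phi
  on C_{1/2} (where every element of H^2 converges absolutely).\<close>
definition comp_diff_rel :: "(complex \<Rightarrow> complex) \<Rightarrow> (nat \<Rightarrow> complex) \<Rightarrow> (nat \<Rightarrow> complex) \<Rightarrow> bool" where
  "comp_diff_rel \<Phi> a b \<longleftrightarrow> b \<in> H2 \<and>
     (\<forall>s \<in> halfplane (1/2). ((\<lambda>m. b m * of_nat m powr (- s)) sums deriv (dir_eval a) (\<Phi> s)))"

definition comp_diff :: "(complex \<Rightarrow> complex) \<Rightarrow> (nat \<Rightarrow> complex) \<Rightarrow> (nat \<Rightarrow> complex)" where
  "comp_diff \<Phi> a = (THE b. comp_diff_rel \<Phi> a b)"

definition comp_diff_well_defined :: "(complex \<Rightarrow> complex) \<Rightarrow> bool" where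
  "comp_diff_well_defined \<Phi> \<longleftrightarrow> (\<forall>a \<in> H2. \<exists>!b. comp_diff_rel \<Phi> a b)"

definition hilbert_schmidt_H2 :: "((nat \<Rightarrow> complex) \<Rightarrow> (nat \<Rightarrow> complex)) \<Rightarrow> bool" where
  "hilbert_schmidt_H2 T \<longleftrightarrow>
     (\<forall>a \<in> H2. T a \<in> H2) \<and>
     (\<forall>a \<in> H2. \<forall>b \<in> H2. \<forall>x y::complex.
        T (\<lambda>m. x * a m + y * b m) = (\<lambda>m. x * T a m + y * T b m)) \<and>
     (\<exists>C. \<forall>a \<in> H2. H2_norm (T a) \<le> C * H2_norm a) \<and>
     summable (\<lambda>n. (H2_norm (T (e_basis (Suc n))))\<^sup>2)"

end

(*
  The means lim 1/(2T) int_{-T}^{T} F(x + it) m^(x + it) dt recover the coefficients of a function F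
  that is a uniform limit of Dirichlet polynomials on some half-plane. If F is moreover bounded
  and holomorphic on Re s > 0, these means do not depend on the line x > 0, so Bessel's
  inequality for means, in the limit x -> 0, gives (sum |b_m|^2)^(1/2) <= sup |F|; then the
  series of F converges for Re s > 1/2 and represents F there by analytic continuation. Boundedness
  thus replaces Bohr's theorem. For a in H^2 this applies to F = f' o Phi, f the series of a:
  it is a uniform limit of combinations of n^(-Phi(s)) = (n^c0)^(-s) exp(-ln n phi(s)) and satisfies
  |F| <= ||a|| (sum (ln n)^2 n^(-2 eps))^(1/2). For a = e_n the bound is ln n n^(-eps), which is
  square summable because eps > 1/2.
*)
theory Submission
  imports Defs "HOL-Complex_Analysis.Complex_Analysis"
begin

section \<open>Mean values over vertical lines\<close>

text \<open>The obstacle is that f' o \<Phi> must be shown to lie in the space at all: the series of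
  \<phi> is known to converge only on some \<open>halfplane \<theta>\<close>, possibly far to the
  right, and left of it only holomorphy and the range of \<Phi> are known. Substituting the series
  of \<phi> into exp would call for rearranging multiple Dirichlet series. Uniform approximation by
  Dirichlet polynomials avoids this: it survives sums, products, exp and uniform limits, and the
  coefficients are read off by means only once the function is complete. Bessel's inequality serves
  twice: on a far line, applied to F minus an approximating polynomial, it shows that the series
  sums to F; on lines near Re s = 0, applied to F itself, it bounds the square sum. Images are
  constructed for an arbitrary sup bound M, because the Cauchy-Schwarz bound is the same for all
  unit vectors and hence not summable over the basis.\<close>

definition has_mean :: "(real \<Rightarrow> complex) \<Rightarrow> complex \<Rightarrow> bool" where
  "has_mean f L \<longleftrightarrow> (\<forall>T. f integrable_on {-T..T}) \<and>
     ((\<lambda>T. integral {-T..T} f / of_real (2 * T)) \<longlongrightarrow> L) at_top"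

lemma has_mean_unique: "has_mean f L \<Longrightarrow> has_mean f L' \<Longrightarrow> L = L'"
  unfolding has_mean_def using tendsto_unique[OF trivial_limit_at_top_linorder] by blast

lemma has_mean_add:
  assumes "has_mean f L" "has_mean g M"
  shows "has_mean (\<lambda>t. f t + g t) (L + M)"
proof -
  have "integral {-T..T} (\<lambda>t. f t + g t) = integral {-T..T} f + integral {-T..T} g" for T
    using assms by (intro integral_add) (auto simp: has_mean_def)
  then show ?thesis
    using assms by (auto simp: has_mean_def add_divide_distrib intro!: integrable_add tendsto_add)
qed

lemma has_mean_cmult:
  assumes "has_mean f L"
  shows "has_mean (\<lambda>t. c * f t) (c * L)"
proof -
  have "integral {-T..T} (\<lambda>t. c * f t) / of_real (2 * T) = c * (integral {-T..T} f / of_real (2 * T))" for T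
    using assms by (simp add: has_mean_def)
  moreover have "(\<lambda>t. c * f t) integrable_on {-T..T}" for T
    using assms integrable_on_mult_right[of f "{-T..T}" c] by (simp add: has_mean_def)
  ultimately show ?thesis
    using assms by (simp only: has_mean_def) (intro conjI allI tendsto_intros, auto)
qed

lemma has_mean_diff:
  assumes "has_mean f L" "has_mean g M"
  shows "has_mean (\<lambda>t. f t - g t) (L - M)"
  using has_mean_add[OF assms(1) has_mean_cmult[OF assms(2), of "-1"]] by simp

lemma has_mean_const: "has_mean (\<lambda>t. c) c"
proof -
  have "\<forall>\<^sub>F T in at_top. integral {-T..T} (\<lambda>t. c) / of_real (2 * T) = c"
    using eventually_gt_at_top[of "0::real"]
    by eventually_elim (auto simp: scaleR_conv_of_real)
  then show ?thesis
    unfolding has_mean_def by (auto intro: tendsto_eventually)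
qed

lemma has_mean_sum:
  assumes "\<And>i. i \<in> A \<Longrightarrow> has_mean (f i) (L i)"
  shows "has_mean (\<lambda>t. \<Sum>i\<in>A. f i t) (\<Sum>i\<in>A. L i)"
  using assms has_mean_const[of 0]
  by (induction A rule: infinite_finite_induct) (auto intro: has_mean_add)

lemma has_mean_cnj:
  assumes "has_mean f L"
  shows "has_mean (\<lambda>t. cnj (f t)) (cnj L)"
proof -
  have i: "((\<lambda>t. cnj (f t)) has_integral cnj (integral {-T..T} f)) {-T..T}" for T
    using assms has_integral_cnj[of f "integral {-T..T} f" "{-T..T}"]
    by (auto simp: has_mean_def o_def integrable_integral)
  have "((\<lambda>T. cnj (integral {-T..T} f / of_real (2 * T))) \<longlongrightarrow> cnj L) at_top"
    using assms by (intro tendsto_cnj) (auto simp: has_mean_def)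
  then show ?thesis
    using i integral_unique[OF i] by (auto simp: has_mean_def integrable_on_def)
qed

lemma has_mean_Re_nonneg:
  assumes "has_mean f L" "\<And>t. 0 \<le> Re (f t)"
  shows "0 \<le> Re L"
proof (rule tendsto_lowerbound[OF _ _ trivial_limit_at_top_linorder])
  show "((\<lambda>T. Re (integral {-T..T} f / of_real (2 * T))) \<longlongrightarrow> Re L) at_top"
    using assms(1) by (intro tendsto_Re) (auto simp: has_mean_def)
  show "\<forall>\<^sub>F T in at_top. 0 \<le> Re (integral {-T..T} f / of_real (2 * T))"
    using eventually_gt_at_top[of "0::real"]
  proof eventually_elim
    case (elim T)
    have i: "(f has_integral (integral {-T..T} f)) {-T..T}"
      using assms(1) by (auto simp: has_mean_def integrable_integral)
    have "0 \<le> Re (integral {-T..T} f)"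
      using has_integral_linear[OF i bounded_linear_Re] assms(2)
      by (auto simp: o_def intro: has_integral_nonneg)
    then show ?case using elim by (simp add: Re_divide_of_real)
  qed
qed

lemma has_mean_bound:
  assumes "has_mean f L" "\<And>t. cmod (f t) \<le> B"
  shows "cmod L \<le> B"
proof (rule tendsto_upperbound[OF _ _ trivial_limit_at_top_linorder])
  show "((\<lambda>T. cmod (integral {-T..T} f / of_real (2 * T))) \<longlongrightarrow> cmod L) at_top"
    using assms(1) by (intro tendsto_norm) (auto simp: has_mean_def)
  show "\<forall>\<^sub>F T in at_top. cmod (integral {-T..T} f / of_real (2 * T)) \<le> B"
    using eventually_gt_at_top[of "0::real"]
  proof eventually_elim
    case (elim T)
    have i: "(f has_integral (integral {-T..T} f)) {-T..T}"
      using assms(1) by (auto simp: has_mean_def integrable_integral)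
    have "0 \<le> B" using assms(2)[of 0] norm_ge_zero order_trans by blast
    then have "cmod (integral {-T..T} f) \<le> B * (2 * T)"
      using has_integral_bound_real[OF _ _ i, of B "{}"] assms(2) elim by auto
    then show ?case using elim by (simp add: norm_divide norm_mult divide_le_eq)
  qed
qed

text \<open>Convergence of L is a conclusion: \<open>has_mean_bound\<close> applied to differences
  makes L Cauchy. The averages of f j over [-T, T] converge to those of g uniformly in T > 0, which
  permits exchanging the limits in j and in T.\<close>

lemma has_mean_uniform_limit:
  assumes "\<And>j. has_mean (f j) (L j)" "uniform_limit UNIV f g sequentially"
    and "continuous_on UNIV g"
  shows "\<exists>l. L \<longlonglongrightarrow> l \<and> has_mean g l"
proof -
  have "Cauchy L"
  proof (rule CauchyI)
    fix e :: real assume "0 < e"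
    then obtain J where J: "\<And>j t. j \<ge> J \<Longrightarrow> dist (f j t) (g t) < e / 3"
      using assms(2) unfolding uniform_limit_sequentially_iff
      by (metis UNIV_I divide_pos_pos zero_less_numeral)
    have *: "cmod (L i - L j) \<le> e / 3 + e / 3" if "i \<ge> J" "j \<ge> J" for i j
    proof (rule has_mean_bound[OF has_mean_diff[OF assms(1)[of i] assms(1)[of j]]])
      fix t
      show "cmod (f i t - f j t) \<le> e / 3 + e / 3"
        using J[OF that(1), of t] J[OF that(2), of t] dist_triangle2[of "f i t" "f j t" "g t"]
        by (simp add: dist_norm)
    qed
    show "\<exists>M. \<forall>m\<ge>M. \<forall>n\<ge>M. norm (L m - L n) < e"
    proof (intro exI[of _ J] allI impI)
      fix m n assume "J \<le> m" "J \<le> n"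
      then show "norm (L m - L n) < e" using *[of m n] \<open>0 < e\<close> by linarith
    qed
  qed
  then obtain l where l: "L \<longlonglongrightarrow> l"
    using Cauchy_convergent_iff convergent_def by blast
  have int: "f j integrable_on {-T..T}" "g integrable_on {-T..T}" for j T
    using assms(1,3) by (auto simp: has_mean_def intro!: integrable_continuous_interval
        intro: continuous_on_subset)
  have ul: "uniform_limit {0<..} (\<lambda>j T. integral {-T..T} (f j) / of_real (2 * T))
      (\<lambda>T. integral {-T..T} g / of_real (2 * T)) sequentially"
  proof (rule uniform_limitI)
    fix e :: real assume e: "0 < e"
    have "\<forall>\<^sub>F j in sequentially. \<forall>t. dist (f j t) (g t) < e / 2"
      using uniform_limitD[OF assms(2), of "e / 2"] e by auto
    then show "\<forall>\<^sub>F j in sequentially. \<forall>T\<in>{0<..}. dist (integral {-T..T} (f j) / of_real (2 * T))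
        (integral {-T..T} g / of_real (2 * T)) < e"
    proof eventually_elim
      case (elim j)
      show ?case
      proof
        fix T :: real assume T: "T \<in> {0<..}"
        have i: "((\<lambda>t. f j t - g t) has_integral (integral {-T..T} (f j) - integral {-T..T} g)) {-T..T}"
          using int by (intro has_integral_diff integrable_integral)
        have "cmod (integral {-T..T} (f j) - integral {-T..T} g) \<le> e / 2 * (2 * T)"
          using has_integral_bound_real[OF _ _ i, of "e / 2" "{}"] elim T e
          by (auto simp: dist_norm less_imp_le)
        also have "\<dots> < e * (2 * T)" using T e by simp
        finally show "dist (integral {-T..T} (f j) / of_real (2 * T))
            (integral {-T..T} g / of_real (2 * T)) < e"
          using T by (simp add: dist_norm diff_divide_distrib[symmetric] norm_divide norm_mult divide_less_eq)
      qed
    qed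
  qed
  have "((\<lambda>T. integral {-T..T} g / of_real (2 * T)) \<longlongrightarrow> l) at_top"
    by (rule swap_uniform_limit'[OF _ l ul])
       (use assms(1) in \<open>auto simp: has_mean_def eventually_gt_at_top\<close>)
  then show ?thesis using l int by (auto simp: has_mean_def)
qed

text \<open>For nonzero l the integral over [-T, T] is at most 2/|l| in modulus, so division by 2T
  sends it to 0. This orthogonality of distinct frequencies underlies every extraction of a
  coefficient.\<close>

lemma has_mean_cis: "has_mean (\<lambda>t. cis (l * t)) (if l = 0 then 1 else 0)"
proof (cases "l = 0")
  case True
  then show ?thesis using has_mean_const[of 1] by simp
next
  case False
  let ?I = "\<lambda>T. (cis (l * T) - cis (l * -T)) / (\<i> * of_real l)"
  have i: "((\<lambda>t. cis (l * t)) has_integral ?I T) {-T..T}" if "0 \<le> T" for T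
  proof -
    have "((\<lambda>t. cis (l * t)) has_integral (cis (l * T) / (\<i> * of_real l) - cis (l * -T) / (\<i> * of_real l))) {-T..T}"
    proof (rule fundamental_theorem_of_calculus)
      fix x :: real
      have "((\<lambda>t. exp (\<i> * of_real l * t) / (\<i> * of_real l)) has_field_derivative exp (\<i> * of_real l * of_real x))
          (at (of_real x))"
        using False by (auto intro!: derivative_eq_intros)
      then have "((\<lambda>t. exp (\<i> * of_real l * of_real t) / (\<i> * of_real l)) has_vector_derivative exp (\<i> * of_real l * of_real x)) (at x within {-T..T})"
        by (rule has_vector_derivative_real_field)
      then show "((\<lambda>t. cis (l * t) / (\<i> * of_real l)) has_vector_derivative cis (l * x)) (at x within {-T..T})"
        by (simp add: cis_conv_exp mult.assoc)
    qed (use that in auto)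
    then show ?thesis by (simp add: diff_divide_distrib)
  qed
  have "((\<lambda>T. ?I T / of_real (2 * T)) \<longlongrightarrow> 0) at_top"
  proof (rule Lim_null_comparison)
    show "\<forall>\<^sub>F T in at_top. norm (?I T / of_real (2 * T)) \<le> (2 / \<bar>l\<bar>) / (2 * T)"
      using eventually_gt_at_top[of "0::real"]
    proof eventually_elim
      case (elim T)
      have "cmod (cis (l * T) - cis (l * -T)) \<le> 2"
        using norm_triangle_ineq4[of "cis (l * T)" "cis (l * -T)"] by simp
      then show ?case using elim divide_right_mono[of _ 2 "\<bar>l\<bar> * (2 * T)"]
        by (simp add: norm_divide norm_mult)
    qed
    show "((\<lambda>T. (2 / \<bar>l\<bar>) / (2 * T)) \<longlongrightarrow> 0) at_top"
      by (real_asymp)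
  qed
  moreover have "\<forall>\<^sub>F T in at_top. ?I T / of_real (2 * T) = integral {-T..T} (\<lambda>t. cis (l * t)) / of_real (2 * T)"
    using eventually_ge_at_top[of "0::real"]
    by eventually_elim (simp add: integral_unique[OF i] del: of_real_mult)
  ultimately have "((\<lambda>T. integral {-T..T} (\<lambda>t. cis (l * t)) / of_real (2 * T)) \<longlongrightarrow> 0) at_top"
    using tendsto_cong[of "\<lambda>T. ?I T / of_real (2 * T)"] by fastforce
  moreover have "(\<lambda>t. cis (l * t)) integrable_on {-T..T}" for T
    by (intro integrable_continuous_interval continuous_intros)
  ultimately show ?thesis using False by (simp add: has_mean_def)
qed

text \<open>The proof expands the mean of \<open>\<bar>f - P\<bar>\<^sup>2 \<ge> 0\<close> for the trigonometric polynomial \<open>P\<close> with coefficients \<open>\<beta>\<close>.\<close>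
lemma mean_Bessel:
  assumes bound: "\<And>t. cmod (f t) \<le> M"
    and mean: "\<And>k. k \<in> A \<Longrightarrow> has_mean (\<lambda>t. f t * cis (l k * t)) (\<beta> k)"
    and "finite A" "inj_on l A"
  shows "(\<Sum>k\<in>A. (cmod (\<beta> k))\<^sup>2) \<le> M\<^sup>2"
proof -
  \<comment> \<open>The frequencies are negated because \<beta> k is the mean against cis (l k t),
    that is, the Fourier coefficient of f at the frequency -(l k).\<close>
  define P where "P t = (\<Sum>k\<in>A. \<beta> k * cis (- (l k * t)))" for t
  define S :: complex where "S = (\<Sum>k\<in>A. \<beta> k * cnj (\<beta> k))"
  have 1: "has_mean (\<lambda>t. f t * cnj (P t)) S"
  proof -
    have "has_mean (\<lambda>t. \<Sum>k\<in>A. cnj (\<beta> k) * (f t * cis (l k * t))) (\<Sum>k\<in>A. cnj (\<beta> k) * \<beta> k)"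
      by (intro has_mean_sum has_mean_cmult mean)
    moreover have "(\<lambda>t. \<Sum>k\<in>A. cnj (\<beta> k) * (f t * cis (l k * t))) = (\<lambda>t. f t * cnj (P t))"
      by (auto simp: P_def sum_distrib_left cis_cnj algebra_simps intro!: ext sum.cong)
    ultimately show ?thesis by (simp add: S_def mult.commute)
  qed
  have cnjS: "cnj S = S" by (simp add: S_def mult.commute)
  have 2: "has_mean (\<lambda>t. cnj (f t) * P t) S"
    using has_mean_cnj[OF 1] cnjS by simp
  have 3: "has_mean (\<lambda>t. P t * cnj (P t)) S"
  proof -
    have "has_mean (\<lambda>t. \<Sum>k\<in>A. \<Sum>j\<in>A. (\<beta> k * cnj (\<beta> j)) * cis ((l j - l k) * t))
        (\<Sum>k\<in>A. \<Sum>j\<in>A. (\<beta> k * cnj (\<beta> j)) * (if l j - l k = 0 then 1 else 0))"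
      by (intro has_mean_sum has_mean_cmult has_mean_cis)
    moreover have "(\<Sum>k\<in>A. \<Sum>j\<in>A. (\<beta> k * cnj (\<beta> j)) * (if l j - l k = 0 then 1 else 0)) = S"
    proof -
      \<comment> \<open>Injectivity of l leaves the diagonal as the only place where two frequencies
        cancel.\<close>
      have "(\<Sum>j\<in>A. (\<beta> k * cnj (\<beta> j)) * (if l j - l k = 0 then 1 else 0))
          = (\<Sum>j\<in>A. if j = k then \<beta> k * cnj (\<beta> j) else 0)" if "k \<in> A" for k
        using that \<open>inj_on l A\<close> by (intro sum.cong) (auto simp: inj_on_def)
      then show ?thesis using \<open>finite A\<close> by (simp add: S_def)
    qed
    moreover have "(\<Sum>k\<in>A. \<Sum>j\<in>A. (\<beta> k * cnj (\<beta> j)) * cis ((l j - l k) * t)) = P t * cnj (P t)" for t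
      by (simp add: P_def sum_product cis_cnj cis_mult algebra_simps)
    ultimately show ?thesis by simp
  qed
  \<comment> \<open>This is |f - P|^2 with |f|^2 replaced by M^2: the mean of |f|^2 is not known to
    exist, and the replacement can only enlarge the integrand.\<close>
  have "has_mean (\<lambda>t. of_real (M\<^sup>2) - f t * cnj (P t) - cnj (f t) * P t + P t * cnj (P t))
      (of_real (M\<^sup>2) - S - S + S)"
    by (intro has_mean_add has_mean_diff has_mean_const 1 2 3)
  then have "0 \<le> Re (of_real (M\<^sup>2) - S - S + S)"
  proof (rule has_mean_Re_nonneg)
    fix t
    have "of_real (M\<^sup>2) - f t * cnj (P t) - cnj (f t) * P t + P t * cnj (P t)
        = of_real (M\<^sup>2 - (cmod (f t))\<^sup>2 + (cmod (f t - P t))\<^sup>2)"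
      unfolding of_real_add of_real_diff complex_norm_square by (simp add: algebra_simps)
    moreover have "(cmod (f t))\<^sup>2 \<le> M\<^sup>2"
      using bound[of t] by (intro power_mono) auto
    ultimately show "0 \<le> Re (of_real (M\<^sup>2) - f t * cnj (P t) - cnj (f t) * P t + P t * cnj (P t))"
      by (simp only: Re_complex_of_real) simp
  qed
  moreover have "S = of_real (\<Sum>k\<in>A. (cmod (\<beta> k))\<^sup>2)"
    unfolding S_def of_real_sum complex_norm_square ..
  ultimately show ?thesis by simp
qed

section \<open>Dirichlet polynomials and their uniform limits\<close>

lemma norm_nat_powr: "cmod (of_nat n powr s) = real n powr Re s"
  by (simp add: norm_powr_real_powr)

text \<open>The principal logarithm of a positive natural is real, so no multiple of 2 pi i disturbs
  its additivity. If a factor is 0, both sides vanish because \<open>0 powr s = 0\<close>.\<close>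

lemma nat_powr_mult: "(of_nat (k * l) :: complex) powr s = of_nat k powr s * of_nat l powr s"
proof (cases "k = 0 \<or> l = 0")
  case False
  then have "ln (of_nat (k * l) :: complex) = ln (of_nat k) + ln (of_nat l)"
    using Ln_of_nat[of "k * l"] by (simp add: Ln_of_nat ln_mult del: of_nat_mult) (simp add: ln_mult)
  with False show ?thesis
    by (simp add: powr_def exp_add[symmetric] algebra_simps flip: of_nat_mult)
qed auto

lemma nat_powr_Complex:
  assumes "0 < n"
  shows "of_nat n powr Complex \<sigma> t = of_real (real n powr \<sigma>) * cis (ln (real n) * t)"
proof -
  have "Complex \<sigma> t = of_real \<sigma> + \<i> * of_real t"
    by (simp add: complex_eq_iff)
  then show ?thesis using assms
    by (simp add: powr_def Ln_of_nat cis_conv_exp exp_of_real[symmetric] exp_add[symmetric] algebra_simps)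
qed

lemma has_field_derivative_nat_powr:
  "((\<lambda>s. of_nat n powr (- s)) has_field_derivative - (of_real (ln (real n)) * of_nat n powr (- s))) (at (s :: complex) within S)"
  by (cases "n = 0") (auto intro!: derivative_eq_intros simp: powr_def Ln_of_nat)

lemma holomorphic_nat_powr [holomorphic_intros]:
  "f holomorphic_on S \<Longrightarrow> (\<lambda>s. of_nat n powr f s) holomorphic_on S"
  by (cases "n = 0") (auto intro!: holomorphic_intros)

lemma continuous_nat_powr [continuous_intros]:
  "continuous_on S f \<Longrightarrow> continuous_on S (\<lambda>s. of_nat n powr (f s :: complex))"
  by (cases "n = 0") (auto simp: powr_def intro!: continuous_intros)

lemma nat_powr_mono: "s \<le> s' \<Longrightarrow> real n powr s \<le> real n powr s'"
  by (cases "n = 0") (auto intro: powr_mono)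

lemma open_halfplane: "open (halfplane \<theta>)"
  by (simp add: halfplane_def open_halfspace_Re_gt)

lemma convex_halfplane: "convex (halfplane \<theta>)"
  by (simp add: halfplane_def convex_halfspace_Re_gt)

text \<open>The hypothesis on x is a bound for partial sums, the form in which both Bessel's
  inequality and the norm of \<open>H2\<close> deliver it.\<close>

lemma Cauchy_Schwarz_suminf:
  fixes x y :: "nat \<Rightarrow> real"
  assumes "\<And>N. (\<Sum>n<N. (x n)\<^sup>2) \<le> A\<^sup>2" "0 \<le> A" "summable (\<lambda>n. (y n)\<^sup>2)"
  shows "summable (\<lambda>n. \<bar>x n\<bar> * \<bar>y n\<bar>)"
    and "(\<Sum>n. \<bar>x n\<bar> * \<bar>y n\<bar>) \<le> A * sqrt (\<Sum>n. (y n)\<^sup>2)"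
proof -
  have bound: "(\<Sum>n<N. \<bar>x n\<bar> * \<bar>y n\<bar>) \<le> A * sqrt (\<Sum>n. (y n)\<^sup>2)" for N
  proof -
    have "(\<Sum>n<N. \<bar>x n\<bar> * \<bar>y n\<bar>) \<le> L2_set x {..<N} * L2_set y {..<N}"
      by (rule L2_set_mult_ineq)
    also have "\<dots> \<le> A * sqrt (\<Sum>n. (y n)\<^sup>2)"
    proof (rule mult_mono)
      show "L2_set x {..<N} \<le> A"
        unfolding L2_set_def using assms(1)[of N] assms(2) by (rule real_le_lsqrt[rotated])
      show "L2_set y {..<N} \<le> sqrt (\<Sum>n. (y n)\<^sup>2)"
        unfolding L2_set_def by (intro real_sqrt_le_mono sum_le_suminf assms) auto
    qed (use assms in auto)
    finally show ?thesis .
  qed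
  show sm: "summable (\<lambda>n. \<bar>x n\<bar> * \<bar>y n\<bar>)"
    by (rule summableI_nonneg_bounded[OF _ bound]) auto
  show "(\<Sum>n. \<bar>x n\<bar> * \<bar>y n\<bar>) \<le> A * sqrt (\<Sum>n. (y n)\<^sup>2)"
    by (rule suminf_le_const[OF sm bound])
qed

section \<open>The algebra of Dirichlet polynomials and its uniform closure\<close>

definition dirichlet_polynomial :: "(complex \<Rightarrow> complex) \<Rightarrow> bool" where
  "dirichlet_polynomial P \<longleftrightarrow> (\<exists>p N. \<forall>s. P s = (\<Sum>n<N. p n * of_nat n powr (- s)))"

lemma dirichlet_polynomial_monomial: "dirichlet_polynomial (\<lambda>s. a * of_nat k powr (- s))"
  unfolding dirichlet_polynomial_def
proof (intro exI allI)
  fix s :: complex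
  have "(\<Sum>n<Suc k. (if n = k then a else 0) * of_nat n powr (- s))
      = (\<Sum>n<Suc k. if n = k then a * of_nat n powr (- s) else 0)"
    by (intro sum.cong) auto
  then show "a * of_nat k powr (- s) = (\<Sum>n<Suc k. (if n = k then a else 0) * of_nat n powr (- s))"
    by simp
qed

lemma dirichlet_polynomial_add:
  assumes "dirichlet_polynomial P" "dirichlet_polynomial Q"
  shows "dirichlet_polynomial (\<lambda>s. P s + Q s)"
proof -
  obtain p N q M where *: "\<And>s. P s = (\<Sum>n<N. p n * of_nat n powr (- s))"
    "\<And>s. Q s = (\<Sum>n<M. q n * of_nat n powr (- s))"
    using assms unfolding dirichlet_polynomial_def by blast
  define r where "r n = (if n < N then p n else 0) + (if n < M then q n else 0)" for n
  have "P s + Q s = (\<Sum>n<max N M. r n * of_nat n powr (- s))" for s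
  proof -
    have "P s = (\<Sum>n<max N M. if n < N then p n * of_nat n powr (- s) else 0)"
      unfolding * by (intro sum.mono_neutral_cong_left) auto
    moreover have "Q s = (\<Sum>n<max N M. if n < M then q n * of_nat n powr (- s) else 0)"
      unfolding * by (intro sum.mono_neutral_cong_left) auto
    ultimately show ?thesis
      by (auto simp: r_def sum.distrib[symmetric] algebra_simps intro!: sum.cong)
  qed
  then show ?thesis unfolding dirichlet_polynomial_def by blast
qed

lemma dirichlet_polynomial_sum:
  assumes "\<And>i. i \<in> A \<Longrightarrow> dirichlet_polynomial (P i)"
  shows "dirichlet_polynomial (\<lambda>s. \<Sum>i\<in>A. P i s)"
  using assms dirichlet_polynomial_monomial[of 0 0]
  by (induction A rule: infinite_finite_induct) (auto intro: dirichlet_polynomial_add)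

text \<open>Each product of monomials is the monomial of index n m. Closure under sums then absorbs
  repeated indices, so the Dirichlet convolution of the coefficients is never formed.\<close>

lemma dirichlet_polynomial_mult:
  assumes "dirichlet_polynomial P" "dirichlet_polynomial Q"
  shows "dirichlet_polynomial (\<lambda>s. P s * Q s)"
proof -
  obtain p N q M where *: "\<And>s. P s = (\<Sum>n<N. p n * of_nat n powr (- s))"
    "\<And>s. Q s = (\<Sum>n<M. q n * of_nat n powr (- s))"
    using assms unfolding dirichlet_polynomial_def by blast
  have "(\<lambda>s. P s * Q s) = (\<lambda>s. \<Sum>n<N. \<Sum>m<M. (p n * q m) * of_nat (n * m) powr (- s))"
    by (simp add: * sum_product nat_powr_mult mult_ac del: of_nat_mult)
  then show ?thesis
    by (simp only:) (intro dirichlet_polynomial_sum dirichlet_polynomial_monomial)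
qed

lemma dirichlet_polynomial_bounded:
  assumes "dirichlet_polynomial P"
  obtains B where "\<And>s. s \<in> halfplane \<sigma> \<Longrightarrow> cmod (P s) \<le> B"
proof -
  obtain p N where P: "\<And>s. P s = (\<Sum>n<N. p n * of_nat n powr (- s))"
    using assms unfolding dirichlet_polynomial_def by blast
  have "cmod (P s) \<le> (\<Sum>n<N. cmod (p n) * real n powr (- \<sigma>))" if "s \<in> halfplane \<sigma>" for s
    unfolding P using that
    by (intro order_trans[OF norm_sum] sum_mono)
       (auto simp: norm_mult norm_nat_powr halfplane_def intro!: mult_left_mono nat_powr_mono)
  then show ?thesis using that by blast
qed

text \<open>The closure of the Dirichlet polynomials in the sup norm over the half-plane. The
  polynomial may change entirely with e; no coefficient sequence is fixed in advance, which is what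
  makes products and exponentials easy to treat.\<close>

definition dirichlet_approximable :: "real \<Rightarrow> (complex \<Rightarrow> complex) \<Rightarrow> bool" where
  "dirichlet_approximable \<sigma> F \<longleftrightarrow>
     (\<forall>e>0. \<exists>P. dirichlet_polynomial P \<and> (\<forall>s\<in>halfplane \<sigma>. cmod (F s - P s) < e))"

lemma dirichlet_approximable_mono:
  assumes "dirichlet_approximable \<sigma> F" "\<sigma> \<le> \<tau>"
  shows "dirichlet_approximable \<tau> F"
proof -
  have "halfplane \<tau> \<subseteq> halfplane \<sigma>" using assms(2) by (auto simp: halfplane_def)
  then show ?thesis using assms(1) unfolding dirichlet_approximable_def by blast
qed

lemma dirichlet_approximable_polynomial: "dirichlet_polynomial P \<Longrightarrow> dirichlet_approximable \<sigma> P"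
  unfolding dirichlet_approximable_def by (auto intro!: exI[of _ P])

lemma dirichlet_approximable_limit:
  assumes "\<And>e. 0 < e \<Longrightarrow> \<exists>G. dirichlet_approximable \<sigma> G \<and> (\<forall>s\<in>halfplane \<sigma>. cmod (F s - G s) < e)"
  shows "dirichlet_approximable \<sigma> F"
  unfolding dirichlet_approximable_def
proof (intro allI impI)
  fix e :: real assume "0 < e"
  then obtain G where G: "dirichlet_approximable \<sigma> G" "\<And>s. s \<in> halfplane \<sigma> \<Longrightarrow> cmod (F s - G s) < e / 2"
    using assms[of "e / 2"] by auto
  obtain P where P: "dirichlet_polynomial P" "\<And>s. s \<in> halfplane \<sigma> \<Longrightarrow> cmod (G s - P s) < e / 2"
    using G(1) \<open>0 < e\<close> unfolding dirichlet_approximable_def by (meson half_gt_zero)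
  have "cmod (F s - P s) < e" if "s \<in> halfplane \<sigma>" for s
    using G(2)[OF that] P(2)[OF that] by (rule norm_diff_triangle_less[THEN less_le_trans]) simp
  then show "\<exists>P. dirichlet_polynomial P \<and> (\<forall>s\<in>halfplane \<sigma>. cmod (F s - P s) < e)"
    using P(1) by blast
qed

lemma dirichlet_approximable_bounded:
  assumes "dirichlet_approximable \<sigma> F"
  obtains B where "0 < B" "\<And>s. s \<in> halfplane \<sigma> \<Longrightarrow> cmod (F s) \<le> B"
proof -
  obtain P where P: "dirichlet_polynomial P" "\<And>s. s \<in> halfplane \<sigma> \<Longrightarrow> cmod (F s - P s) < 1"
    using assms unfolding dirichlet_approximable_def by (meson zero_less_one)
  obtain B where B: "\<And>s. s \<in> halfplane \<sigma> \<Longrightarrow> cmod (P s) \<le> B"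
    using dirichlet_polynomial_bounded[OF P(1)] by blast
  have "cmod (F s) \<le> \<bar>B\<bar> + 1" if "s \<in> halfplane \<sigma>" for s
    using P(2)[OF that] B[OF that] norm_triangle_sub[of "F s" "P s"] by linarith
  then show ?thesis using that[of "\<bar>B\<bar> + 1"] by force
qed

lemma dirichlet_approximable_add:
  assumes "dirichlet_approximable \<sigma> F" "dirichlet_approximable \<sigma> G"
  shows "dirichlet_approximable \<sigma> (\<lambda>s. F s + G s)"
  unfolding dirichlet_approximable_def
proof (intro allI impI)
  fix e :: real assume "0 < e"
  then obtain P Q where PQ: "dirichlet_polynomial P" "\<And>s. s \<in> halfplane \<sigma> \<Longrightarrow> cmod (F s - P s) < e / 2"
    "dirichlet_polynomial Q" "\<And>s. s \<in> halfplane \<sigma> \<Longrightarrow> cmod (G s - Q s) < e / 2"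
    using assms unfolding dirichlet_approximable_def by (meson half_gt_zero)
  have "cmod ((F s + G s) - (P s + Q s)) < e" if "s \<in> halfplane \<sigma>" for s
    using norm_diff_triangle_ineq[of "F s" "G s" "P s" "Q s"] PQ(2,4)[OF that] by linarith
  then show "\<exists>P. dirichlet_polynomial P \<and> (\<forall>s\<in>halfplane \<sigma>. cmod (F s + G s - P s) < e)"
    using dirichlet_polynomial_add[OF PQ(1,3)] by blast
qed

lemma dirichlet_approximable_mult:
  assumes "dirichlet_approximable \<sigma> F" "dirichlet_approximable \<sigma> G"
  shows "dirichlet_approximable \<sigma> (\<lambda>s. F s * G s)"
  unfolding dirichlet_approximable_def
proof (intro allI impI)
  fix e :: real assume "0 < e"
  obtain A where A: "0 < A" "\<And>s. s \<in> halfplane \<sigma> \<Longrightarrow> cmod (F s) \<le> A"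
    using dirichlet_approximable_bounded[OF assms(1)] by blast
  have "0 < e / (2 * A)" using \<open>0 < e\<close> A by simp
  then obtain Q where Q: "dirichlet_polynomial Q" "\<And>s. s \<in> halfplane \<sigma> \<Longrightarrow> cmod (G s - Q s) < e / (2 * A)"
    using assms(2) unfolding dirichlet_approximable_def by meson
  \<comment> \<open>Q is fixed before P, because the tolerance allowed for P depends on the bound of
    Q.\<close>
  obtain B where B: "0 < B" "\<And>s. s \<in> halfplane \<sigma> \<Longrightarrow> cmod (Q s) \<le> B"
    using dirichlet_approximable_bounded[OF dirichlet_approximable_polynomial[OF Q(1)]] by blast
  have "0 < e / (2 * B)" using \<open>0 < e\<close> B by simp
  then obtain P where P: "dirichlet_polynomial P" "\<And>s. s \<in> halfplane \<sigma> \<Longrightarrow> cmod (F s - P s) < e / (2 * B)"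
    using assms(1) unfolding dirichlet_approximable_def by meson
  have "cmod (F s * G s - P s * Q s) < e" if s: "s \<in> halfplane \<sigma>" for s
  proof -
    have "F s * G s - P s * Q s = F s * (G s - Q s) + (F s - P s) * Q s"
      by (simp add: algebra_simps)
    then have "cmod (F s * G s - P s * Q s) \<le> cmod (F s) * cmod (G s - Q s) + cmod (F s - P s) * cmod (Q s)"
      by (metis norm_mult norm_triangle_ineq)
    also have "\<dots> \<le> A * cmod (G s - Q s) + cmod (F s - P s) * B"
      by (intro add_mono mult_mono A B s) (use A B in auto)
    also have "\<dots> < A * (e / (2 * A)) + e / (2 * B) * B"
      by (intro add_strict_mono mult_strict_left_mono mult_strict_right_mono A B P Q s)
    also have "\<dots> = e" using A B by simp
    finally show ?thesis .
  qed
  then show "\<exists>P. dirichlet_polynomial P \<and> (\<forall>s\<in>halfplane \<sigma>. cmod (F s * G s - P s) < e)"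
    using dirichlet_polynomial_mult[OF P(1) Q(1)] by blast
qed

lemma dirichlet_approximable_const: "dirichlet_approximable \<sigma> (\<lambda>s. a)"
  using dirichlet_approximable_polynomial[OF dirichlet_polynomial_monomial[of a 1]] by simp

lemma dirichlet_approximable_power:
  "dirichlet_approximable \<sigma> F \<Longrightarrow> dirichlet_approximable \<sigma> (\<lambda>s. F s ^ k)"
  by (induction k) (auto intro: dirichlet_approximable_mult dirichlet_approximable_const)

lemma dirichlet_approximable_sum:
  assumes "\<And>i. i \<in> A \<Longrightarrow> dirichlet_approximable \<sigma> (F i)"
  shows "dirichlet_approximable \<sigma> (\<lambda>s. \<Sum>i\<in>A. F i s)"
  using assms dirichlet_approximable_const[of \<sigma> 0]
  by (induction A rule: infinite_finite_induct) (auto intro: dirichlet_approximable_add)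

text \<open>An approximable function is bounded, say by R, and the Taylor polynomials of exp
  converge uniformly on the disc of radius R; each of them keeps F approximable.\<close>

lemma dirichlet_approximable_exp:
  assumes "dirichlet_approximable \<sigma> F"
  shows "dirichlet_approximable \<sigma> (\<lambda>s. exp (F s))"
proof (rule dirichlet_approximable_limit)
  fix e :: real assume "0 < e"
  obtain R where R: "0 < R" "\<And>s. s \<in> halfplane \<sigma> \<Longrightarrow> cmod (F s) \<le> R"
    using dirichlet_approximable_bounded[OF assms] by blast
  have "(\<lambda>n. exp R * R * (R ^ n / fact n)) \<longlonglongrightarrow> exp R * R * 0"
    using summable_LIMSEQ_zero[OF summable_exp[of R]]
    by (intro tendsto_mult tendsto_const) (simp add: divide_inverse mult.commute)
  then have "\<forall>\<^sub>F n in sequentially. exp R * R * (R ^ n / fact n) < e"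
    using \<open>0 < e\<close> by (intro order_tendstoD) auto
  then obtain n where n: "exp R * R * (R ^ n / fact n) < e"
    by (auto simp: eventually_sequentially)
  have "cmod (exp (F s) - (\<Sum>k\<le>n. F s ^ k * (1 / fact k))) < e" if "s \<in> halfplane \<sigma>" for s
  proof -
    have "cmod (exp (F s) - (\<Sum>k\<le>n. F s ^ k * (1 / fact k)))
        \<le> exp (cmod (F s)) * cmod (F s) ^ Suc n / fact n"
      using Taylor_exp_field[of "F s" n] by simp
    also have "\<dots> \<le> exp R * R ^ Suc n / fact n"
      using R(2)[OF that] by (intro divide_right_mono mult_mono power_mono) auto
    also have "\<dots> < e" using n by (simp add: mult_ac)
    finally show ?thesis .
  qed
  moreover have "dirichlet_approximable \<sigma> (\<lambda>s. \<Sum>k\<le>n. F s ^ k * (1 / fact k))"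
    by (intro dirichlet_approximable_sum dirichlet_approximable_mult dirichlet_approximable_power
        dirichlet_approximable_const assms)
  ultimately show "\<exists>G. dirichlet_approximable \<sigma> G \<and> (\<forall>s\<in>halfplane \<sigma>. cmod (exp (F s) - G s) < e)"
    by blast
qed

section \<open>Recovering the coefficients\<close>

text \<open>For n \<ge> 1, n^(-s) m^s has modulus (m/n)^\<sigma> and frequency ln m - ln n along the
  line. Only n = m survives, with modulus 1, so the mean is the bare coefficient whatever \<sigma>
  is.\<close>

lemma has_mean_dirichlet_polynomial:
  assumes "0 < m"
  shows "has_mean (\<lambda>t. (\<Sum>n<N. p n * of_nat n powr (- Complex \<sigma> t)) * of_nat m powr Complex \<sigma> t)
    (if m < N then p m else 0)"
proof -
  \<comment> \<open>Since \<open>ln 0 = 0\<close> is also the frequency of n = 1, it matters that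
    the coefficient at index 0 is 0.\<close>
  let ?c = "\<lambda>n. p n * of_real (real n powr (- \<sigma>) * real m powr \<sigma>) * (if n = 0 then 0 else 1)"
  have "has_mean (\<lambda>t. \<Sum>n<N. ?c n * cis ((ln (real m) - ln (real n)) * t))
      (\<Sum>n<N. ?c n * (if ln (real m) - ln (real n) = 0 then 1 else 0))"
    by (intro has_mean_sum has_mean_cmult has_mean_cis)
  moreover have "(\<Sum>n<N. ?c n * (if ln (real m) - ln (real n) = 0 then 1 else 0)) = (if m < N then p m else 0)"
  proof -
    have "(\<Sum>n<N. ?c n * (if ln (real m) - ln (real n) = 0 then 1 else 0)) = (\<Sum>n<N. if n = m then p m else 0)"
      using assms by (intro sum.cong) (auto simp: powr_minus)
    then show ?thesis by simp
  qed
  moreover have "(\<Sum>n<N. ?c n * cis ((ln (real m) - ln (real n)) * t))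
      = (\<Sum>n<N. p n * of_nat n powr (- Complex \<sigma> t)) * of_nat m powr Complex \<sigma> t" for t
  proof -
    have "?c n * cis ((ln (real m) - ln (real n)) * t)
        = p n * of_nat n powr (- Complex \<sigma> t) * of_nat m powr Complex \<sigma> t" for n
    proof (cases "n = 0")
      case False
      have "- Complex \<sigma> t = Complex (- \<sigma>) (- t)" by (simp add: complex_eq_iff)
      then show ?thesis
        using False assms by (simp add: nat_powr_Complex cis_mult algebra_simps)
    qed simp
    then show ?thesis by (simp only: sum_distrib_right)
  qed
  ultimately show ?thesis by simp
qed

text \<open>Multiplying by m^s rather than by its unimodular part normalises b m to be a Dirichlet
  coefficient. The Fourier coefficient of F along the line is then b m times m^(-\<sigma>), whence
  the weight; the frequencies ln m are distinct for m \<ge> 1.\<close>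

lemma mean_Bessel_vertical:
  assumes "\<And>t. cmod (F (Complex \<sigma> t)) \<le> M"
    and "\<And>m. 0 < m \<Longrightarrow> has_mean (\<lambda>t. F (Complex \<sigma> t) * of_nat m powr Complex \<sigma> t) (b m)"
    and "b 0 = 0"
  shows "(\<Sum>m<K. (cmod (b m) * real m powr (- \<sigma>))\<^sup>2) \<le> M\<^sup>2"
proof -
  have "(\<Sum>m\<in>{1..<K}. (cmod (of_real (real m powr (- \<sigma>)) * b m))\<^sup>2) \<le> M\<^sup>2"
  proof (rule mean_Bessel[where f = "\<lambda>t. F (Complex \<sigma> t)" and l = "\<lambda>m. ln (real m)"])
    fix m assume "m \<in> {1..<K}"
    then have m: "0 < m" by simp
    have "has_mean (\<lambda>t. of_real (real m powr (- \<sigma>)) * (F (Complex \<sigma> t) * of_nat m powr Complex \<sigma> t))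
        (of_real (real m powr (- \<sigma>)) * b m)"
      by (rule has_mean_cmult[OF assms(2)[OF m]])
    moreover have "of_real (real m powr (- \<sigma>)) * (F (Complex \<sigma> t) * of_nat m powr Complex \<sigma> t)
        = F (Complex \<sigma> t) * cis (ln (real m) * t)" for t
    proof -
      have "complex_of_real (real m powr (- \<sigma>)) * of_real (real m powr \<sigma>) = 1"
        using m by (simp add: powr_minus flip: of_real_mult)
      then show ?thesis by (simp add: nat_powr_Complex[OF m] mult.left_commute mult.assoc[symmetric])
    qed
    ultimately show "has_mean (\<lambda>t. F (Complex \<sigma> t) * cis (ln (real m) * t)) (of_real (real m powr (- \<sigma>)) * b m)"
      by simp
  qed (use assms in \<open>auto simp: inj_on_def\<close>)
  moreover have "(\<Sum>m<K. (cmod (b m) * real m powr (- \<sigma>))\<^sup>2)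
      = (\<Sum>m\<in>{1..<K}. (cmod (of_real (real m powr (- \<sigma>)) * b m))\<^sup>2)"
    using assms(3) by (intro sum.mono_neutral_cong_right) (auto simp: norm_mult mult.commute not_less_eq_eq)
  ultimately show ?thesis by simp
qed

text \<open>A primitive of \<open>F(s) m\<^sup>s\<close> is Lipschitz on the strip between the two lines,
  so the two integrals over \<open>[-T, T]\<close> differ by a bounded amount.\<close>
lemma has_mean_shift:
  assumes holo: "F holomorphic_on halfplane 0"
    and bound: "\<And>s. s \<in> halfplane 0 \<Longrightarrow> cmod (F s) \<le> M"
    and pos: "0 < \<sigma>" "0 < \<tau>"
    and mean: "has_mean (\<lambda>t. F (Complex \<sigma> t) * of_nat m powr Complex \<sigma> t) L"
  shows "has_mean (\<lambda>t. F (Complex \<tau> t) * of_nat m powr Complex \<tau> t) L"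
proof -
  define G where "G s = F s * of_nat m powr s" for s
  have "G holomorphic_on halfplane 0"
    unfolding G_def by (intro holomorphic_intros holo)
  then obtain H where H: "\<And>s. s \<in> halfplane 0 \<Longrightarrow> (H has_field_derivative G s) (at s)"
    using holomorphic_convex_primitive'[OF convex_halfplane open_halfplane, of G 0]
      at_within_open[OF _ open_halfplane] by (metis (no_types))
  have int: "((\<lambda>t. G (Complex x t)) has_integral ((H (Complex x T) - H (Complex x (-T))) / \<i>)) {-T..T}"
    if "0 < x" "0 \<le> T" for x T
  proof -
    have "((\<lambda>t. G (Complex x t)) has_integral (H (Complex x T) / \<i> - H (Complex x (-T)) / \<i>)) {-T..T}"
    proof (rule fundamental_theorem_of_calculus)
      fix t
      have eq: "Complex x t = of_real x + \<i> * of_real t" for t by (simp add: complex_eq_iff)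
      have d: "(H has_field_derivative G (Complex x t)) (at (of_real x + \<i> * of_real t))"
        using H[of "Complex x t"] that by (simp add: halfplane_def eq)
      have "((\<lambda>z. H (of_real x + \<i> * z)) has_field_derivative G (Complex x t) * \<i>) (at (of_real t))"
        by (rule DERIV_chain2[where g = "\<lambda>z. of_real x + \<i> * z", OF d]) (auto intro!: derivative_eq_intros)
      from DERIV_cdivide[OF this, of \<i>]
      have "((\<lambda>z. H (of_real x + \<i> * z) / \<i>) has_field_derivative G (Complex x t)) (at (of_real t))"
        by (simp only: nonzero_mult_div_cancel_right[OF complex_i_not_zero])
      then have "((\<lambda>t. H (of_real x + \<i> * of_real t) / \<i>) has_vector_derivative G (Complex x t)) (at t within {-T..T})"
        by (rule has_vector_derivative_real_field)
      then show "((\<lambda>t. H (Complex x t) / \<i>) has_vector_derivative G (Complex x t)) (at t within {-T..T})"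
        by (simp add: eq)
    qed (use that in auto)
    then show ?thesis by (simp only: diff_divide_distrib)
  qed
  \<comment> \<open>The modulus of m^s grows with Re s, so the strip is capped on the right at the
    larger abscissa.\<close>
  define B where "B = \<bar>M\<bar> * real m powr (max \<sigma> \<tau>)"
  have GB: "cmod (G s) \<le> B" if "0 < Re s" "Re s \<le> max \<sigma> \<tau>" for s
    unfolding G_def B_def norm_mult norm_nat_powr
    using bound[of s] that
    by (intro mult_mono) (auto simp: halfplane_def nat_powr_mono intro: order_trans)
  have HB: "cmod (H (Complex \<sigma> T) - H (Complex \<tau> T)) \<le> B * \<bar>\<sigma> - \<tau>\<bar>" for T
  proof -
    let ?S = "{s. Re s > 0} \<inter> {s. Re s \<le> max \<sigma> \<tau>}"
    have "cmod (H (Complex \<sigma> T) - H (Complex \<tau> T)) \<le> B * cmod (Complex \<sigma> T - Complex \<tau> T)"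
    proof (rule field_differentiable_bound[where S = ?S and f' = G])
      show "convex ?S" by (intro convex_Int convex_halfspace_Re_gt convex_halfspace_Re_le)
      show "(H has_field_derivative G z) (at z within ?S)" if "z \<in> ?S" for z
        using H[of z] that by (auto simp: halfplane_def intro: has_field_derivative_at_within)
      show "cmod (G z) \<le> B" if "z \<in> ?S" for z
        using GB that by auto
    qed (use pos in auto)
    moreover have "Complex \<sigma> T - Complex \<tau> T = of_real (\<sigma> - \<tau>)" by (simp add: complex_eq_iff)
    ultimately show ?thesis by (simp del: of_real_diff)
  qed
  have intG: "(\<lambda>t. G (Complex x t)) integrable_on {-T..T}" if "0 < x" for x T
    using int[OF that, of T] by (cases "0 \<le> T") auto
  have "((\<lambda>T. integral {-T..T} (\<lambda>t. G (Complex \<tau> t)) / of_real (2 * T)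
      - integral {-T..T} (\<lambda>t. G (Complex \<sigma> t)) / of_real (2 * T)) \<longlongrightarrow> 0) at_top"
  proof (rule Lim_null_comparison)
    show "\<forall>\<^sub>F T in at_top. norm (integral {-T..T} (\<lambda>t. G (Complex \<tau> t)) / of_real (2 * T)
      - integral {-T..T} (\<lambda>t. G (Complex \<sigma> t)) / of_real (2 * T)) \<le> (2 * (B * \<bar>\<sigma> - \<tau>\<bar>)) / (2 * T)"
      using eventually_gt_at_top[of "0::real"]
    proof eventually_elim
      case (elim T)
      \<comment> \<open>Cauchy's theorem on the rectangle between the two lines: the vertical
        integrals differ by the contributions of the two horizontal sides, written as increments of
        H.\<close>
      have eq: "integral {-T..T} (\<lambda>t. G (Complex \<tau> t)) - integral {-T..T} (\<lambda>t. G (Complex \<sigma> t))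
          = ((H (Complex \<sigma> (-T)) - H (Complex \<tau> (-T))) - (H (Complex \<sigma> T) - H (Complex \<tau> T))) / \<i>"
        by (simp only: integral_unique[OF int[OF pos(1) less_imp_le[OF elim]]]
            integral_unique[OF int[OF pos(2) less_imp_le[OF elim]]]) (simp add: algebra_simps)
      have le: "cmod (integral {-T..T} (\<lambda>t. G (Complex \<tau> t)) - integral {-T..T} (\<lambda>t. G (Complex \<sigma> t)))
          \<le> B * \<bar>\<sigma> - \<tau>\<bar> + B * \<bar>\<sigma> - \<tau>\<bar>"
        unfolding eq norm_divide norm_ii div_by_1
        by (intro order_trans[OF norm_triangle_ineq4] add_mono HB)
      show ?case
        using divide_right_mono[OF le, of "2 * T"] elim
        by (simp add: diff_divide_distrib[symmetric] norm_divide norm_mult)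
    qed
    show "((\<lambda>T. (2 * (B * \<bar>\<sigma> - \<tau>\<bar>)) / (2 * T)) \<longlongrightarrow> 0) at_top"
      by real_asymp
  qed
  moreover have "((\<lambda>T. integral {-T..T} (\<lambda>t. G (Complex \<sigma> t)) / of_real (2 * T)) \<longlongrightarrow> L) at_top"
    using mean by (simp add: has_mean_def G_def)
  ultimately have "((\<lambda>T. integral {-T..T} (\<lambda>t. G (Complex \<tau> t)) / of_real (2 * T)) \<longlongrightarrow> L) at_top"
    by (rule Lim_transform[rotated])
  then show ?thesis
    using intG[OF pos(2)] by (simp add: has_mean_def G_def)
qed

text \<open>Bessel's inequality for F minus an approximant bounds the distance of the coefficients
  in the l^2 norm with weight m^(-\<tau>). Cauchy-Schwarz turns this into a bound for the series at
  s when Re s exceeds \<tau> by more than 1/2, and the error tends to 0 with that of the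
  approximation.\<close>

lemma dirichlet_approximable_series:
  assumes approx: "dirichlet_approximable \<sigma> F" and cont: "continuous_on (halfplane \<sigma>) F"
    and less: "\<sigma> < \<tau>"
  obtains b where "b 0 = 0"
    and "\<And>m. 0 < m \<Longrightarrow> has_mean (\<lambda>t. F (Complex \<tau> t) * of_nat m powr Complex \<tau> t) (b m)"
    and "\<And>s. s \<in> halfplane (\<tau> + 1/2) \<Longrightarrow> (\<lambda>m. b m * of_nat m powr (- s)) sums F s"
proof -
  define e where "e j = inverse (real (Suc j))" for j
  have e: "0 < e j" for j by (simp add: e_def)
  have e0: "e \<longlonglongrightarrow> 0" unfolding e_def by (rule LIMSEQ_inverse_real_of_nat)
  have "\<exists>p N. \<forall>s\<in>halfplane \<sigma>. cmod (F s - (\<Sum>n<N. p n * of_nat n powr (- s))) < e j" for j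
    using approx e[of j] unfolding dirichlet_approximable_def dirichlet_polynomial_def by metis
  then obtain p N where pN: "\<And>j s. s \<in> halfplane \<sigma> \<Longrightarrow>
      cmod (F s - (\<Sum>n<N j. p j n * of_nat n powr (- s))) < e j"
    by metis
  define P where "P j s = (\<Sum>n<N j. p j n * of_nat n powr (- s))" for j s
  \<comment> \<open>p j may hold anything at index 0 and from N j on. Setting these entries to 0
    yields the sequence that the means recover, with the same polynomial because
    \<open>0 powr z = 0\<close>.\<close>
  define q where "q j m = (if 0 < m \<and> m < N j then p j m else 0)" for j m
  have FP: "cmod (F s - P j s) < e j" if "s \<in> halfplane \<sigma>" for j s
    using pN[OF that] by (simp add: P_def)
  have line: "Complex \<tau> t \<in> halfplane \<sigma>" for t using less by (simp add: halfplane_def)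
  have meanP: "has_mean (\<lambda>t. P j (Complex \<tau> t) * of_nat m powr Complex \<tau> t) (q j m)" if "0 < m" for j m
    using has_mean_dirichlet_polynomial[OF that, where N = "N j" and p = "p j" and \<sigma> = \<tau>] that by (simp add: P_def q_def)
  have "\<exists>l. has_mean (\<lambda>t. F (Complex \<tau> t) * of_nat m powr Complex \<tau> t) l" if "0 < m" for m
  proof -
    have eq: "Complex \<tau> = (\<lambda>t. of_real \<tau> + \<i> * of_real t)" by (auto simp: complex_eq_iff)
    have line_cont: "continuous_on UNIV (Complex \<tau>)"
      unfolding eq by (intro continuous_intros)
    have "continuous_on UNIV (\<lambda>t. F (Complex \<tau> t))"
      by (rule continuous_on_compose2[OF cont line_cont]) (use line in auto)
    then have "continuous_on UNIV (\<lambda>t. F (Complex \<tau> t) * of_nat m powr Complex \<tau> t)"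
      by (intro continuous_intros line_cont)
    moreover have "uniform_limit UNIV (\<lambda>j t. P j (Complex \<tau> t) * of_nat m powr Complex \<tau> t)
        (\<lambda>t. F (Complex \<tau> t) * of_nat m powr Complex \<tau> t) sequentially"
    proof (rule uniform_limitI)
      fix d :: real assume "0 < d"
      have "(\<lambda>j. e j * real m powr \<tau>) \<longlonglongrightarrow> 0 * real m powr \<tau>"
        by (intro tendsto_intros e0)
      then have "\<forall>\<^sub>F j in sequentially. e j * real m powr \<tau> < d"
        using \<open>0 < d\<close> by (intro order_tendstoD) auto
      then show "\<forall>\<^sub>F j in sequentially. \<forall>t\<in>UNIV. dist (P j (Complex \<tau> t) * of_nat m powr Complex \<tau> t)
          (F (Complex \<tau> t) * of_nat m powr Complex \<tau> t) < d"
      proof eventually_elim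
        case (elim j)
        have "cmod (F (Complex \<tau> t) - P j (Complex \<tau> t)) * real m powr \<tau> \<le> e j * real m powr \<tau>" for t
          using FP[OF line[of t], of j] by (intro mult_right_mono) auto
        then show ?case using elim
          by (auto simp: dist_norm norm_minus_commute norm_mult norm_nat_powr left_diff_distrib[symmetric]
              intro: le_less_trans)
      qed
    qed
    ultimately show ?thesis
      using has_mean_uniform_limit[where L = "\<lambda>j. q j m", OF meanP[OF that]] by blast
  qed
  then obtain b' where b': "\<And>m. 0 < m \<Longrightarrow> has_mean (\<lambda>t. F (Complex \<tau> t) * of_nat m powr Complex \<tau> t) (b' m)"
    by metis
  define b where "b m = (if m = 0 then 0 else b' m)" for m
  have mean: "has_mean (\<lambda>t. F (Complex \<tau> t) * of_nat m powr Complex \<tau> t) (b m)" if "0 < m" for m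
    using b'[OF that] that by (simp add: b_def)
  have b0: "b 0 = 0" by (simp add: b_def)
  have Bessel: "(\<Sum>m<K. (cmod (b m - q j m) * real m powr (- \<tau>))\<^sup>2) \<le> (e j)\<^sup>2" for j K
  proof (rule mean_Bessel_vertical)
    show "cmod (F (Complex \<tau> t) - P j (Complex \<tau> t)) \<le> e j" for t
      using FP[OF line] by (simp add: less_imp_le)
    show "has_mean (\<lambda>t. (F (Complex \<tau> t) - P j (Complex \<tau> t)) * of_nat m powr Complex \<tau> t) (b m - q j m)"
      if "0 < m" for m
      using has_mean_diff[OF mean[OF that] meanP[OF that, of j]] by (simp add: left_diff_distrib)
  qed (simp add: b0 q_def)
  have "(\<lambda>m. b m * of_nat m powr (- s)) sums F s" if s: "s \<in> halfplane (\<tau> + 1/2)" for s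
  proof -
    \<comment> \<open>The modulus of m^(-s) is m^(-\<tau>) times y m: the first factor is the weight
      in \<open>Bessel\<close>, the second is square summable as Re s - \<tau> > 1/2.\<close>
    define y where "y m = real m powr (- (Re s - \<tau>))" for m
    have y: "summable (\<lambda>m. (y m)\<^sup>2)"
    proof -
      have "(y m)\<^sup>2 = real m powr (- (2 * (Re s - \<tau>)))" for m
        by (simp add: y_def power2_eq_square powr_add[symmetric])
      then show ?thesis using s by (simp add: summable_real_powr_iff halfplane_def)
    qed
    have xy: "cmod ((b m - q j m) * of_nat m powr (- s)) = \<bar>cmod (b m - q j m) * real m powr (- \<tau>)\<bar> * \<bar>y m\<bar>" for j m
      by (simp add: norm_mult norm_nat_powr y_def powr_add[symmetric])
    define C where "C = sqrt (\<Sum>m. (y m)\<^sup>2)"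
    have sm: "summable (\<lambda>m. cmod ((b m - q j m) * of_nat m powr (- s)))"
      and le: "(\<Sum>m. cmod ((b m - q j m) * of_nat m powr (- s))) \<le> e j * C" for j
      using Cauchy_Schwarz_suminf[OF Bessel less_imp_le[OF e] y, of j] unfolding xy C_def by auto
    have sq: "(\<lambda>m. q j m * of_nat m powr (- s)) sums P j s" for j
    proof -
      have "(\<lambda>m. q j m * of_nat m powr (- s)) sums (\<Sum>n<N j. q j n * of_nat n powr (- s))"
        by (rule sums_finite) (auto simp: q_def)
      moreover have "(\<Sum>n<N j. q j n * of_nat n powr (- s)) = P j s"
        unfolding P_def by (intro sum.cong) (auto simp: q_def)
      ultimately show ?thesis by simp
    qed
    define D where "D = (\<Sum>m. b m * of_nat m powr (- s))"
    \<comment> \<open>b is the finitely supported q 0 plus an error whose series converges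
      absolutely; any index j would serve.\<close>
    have sb: "summable (\<lambda>m. b m * of_nat m powr (- s))"
      using summable_add[OF summable_norm_cancel[OF sm[of 0]] sums_summable[OF sq[of 0]]]
      by (simp add: left_diff_distrib)
    have "cmod (D - P j s) \<le> e j * C" for j
    proof -
      have "D - P j s = (\<Sum>m. (b m - q j m) * of_nat m powr (- s))"
        unfolding D_def sums_unique[OF sq]
        by (subst suminf_diff[OF sb sums_summable[OF sq]]) (simp add: left_diff_distrib)
      then show ?thesis using order_trans[OF summable_norm[OF sm[of j]] le[of j]] by simp
    qed
    moreover have "cmod (F s - P j s) \<le> e j" for j
      using FP[of s j] s less by (simp add: halfplane_def)
    ultimately have "cmod (D - F s) \<le> e j * C + e j" for j
      using norm_diff_triangle_le[of D "P j s" "e j * C" "F s" "e j"] by (simp add: norm_minus_commute)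
    moreover have "(\<lambda>j. e j * C + e j) \<longlonglongrightarrow> 0 * C + 0"
      by (intro tendsto_intros e0)
    ultimately have "cmod (D - F s) \<le> 0"
      by (intro LIMSEQ_le_const[where X = "\<lambda>j. e j * C + e j"]) auto
    then show ?thesis using summable_sums[OF sb] by (simp add: D_def)
  qed
  with mean b0 that show ?thesis by blast
qed

section \<open>Square summable coefficients\<close>

lemma H2_norm_nonneg: "a \<in> H2 \<Longrightarrow> 0 \<le> H2_norm a"
  by (auto simp: H2_norm_def H2_def intro!: suminf_nonneg)

lemma H2_norm_power2: "a \<in> H2 \<Longrightarrow> (H2_norm a)\<^sup>2 = (\<Sum>n. (cmod (a n))\<^sup>2)"
  by (auto simp: H2_norm_def H2_def intro!: real_sqrt_pow2 suminf_nonneg)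

lemma H2_partial_sum_le: "a \<in> H2 \<Longrightarrow> (\<Sum>n<N. (cmod (a n))\<^sup>2) \<le> (H2_norm a)\<^sup>2"
  unfolding H2_norm_power2 by (auto simp: H2_def intro!: sum_le_suminf)

lemma H2I:
  assumes "a 0 = 0" "0 \<le> M" "\<And>N. (\<Sum>n<N. (cmod (a n))\<^sup>2) \<le> M\<^sup>2"
  shows "a \<in> H2" "H2_norm a \<le> M"
proof -
  have s: "summable (\<lambda>n. (cmod (a n))\<^sup>2)"
    by (rule summableI_nonneg_bounded[OF _ assms(3)]) simp
  then show "a \<in> H2" using assms(1) by (simp add: H2_def)
  show "H2_norm a \<le> M"
    unfolding H2_norm_def using suminf_le_const[OF s assms(3)] assms(2) by (rule real_le_lsqrt[rotated])
qed

lemma H2_lincomb: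
  assumes "a \<in> H2" "b \<in> H2"
  shows "(\<lambda>m. x * a m + y * b m) \<in> H2"
proof -
  have "summable (\<lambda>m. 2 * ((cmod x)\<^sup>2 * (cmod (a m))\<^sup>2) + 2 * ((cmod y)\<^sup>2 * (cmod (b m))\<^sup>2))"
    using assms by (intro summable_add summable_mult) (auto simp: H2_def)
  then have "summable (\<lambda>m. (cmod (x * a m + y * b m))\<^sup>2)"
  proof (rule summable_comparison_test'[where N = 0])
    fix m
    have "(cmod (x * a m + y * b m))\<^sup>2 \<le> (cmod (x * a m) + cmod (y * b m))\<^sup>2"
      by (intro power_mono norm_triangle_ineq) auto
    also have "\<dots> \<le> 2 * (cmod (x * a m))\<^sup>2 + 2 * (cmod (y * b m))\<^sup>2"
      using zero_le_power2[of "cmod (x * a m) - cmod (y * b m)"] by (simp add: power2_eq_square algebra_simps)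
    finally show "norm ((cmod (x * a m + y * b m))\<^sup>2)
        \<le> 2 * ((cmod x)\<^sup>2 * (cmod (a m))\<^sup>2) + 2 * ((cmod y)\<^sup>2 * (cmod (b m))\<^sup>2)"
      by (simp add: norm_mult power_mult_distrib)
  qed
  with assms show ?thesis by (simp add: H2_def)
qed

section \<open>Absolute convergence and termwise differentiation for Re s > 1/2\<close>

lemma summable_square_nat_powr:
  assumes "1/2 < \<sigma>"
  shows "summable (\<lambda>n. (real n powr (- \<sigma>))\<^sup>2)"
proof -
  have "(real n powr (- \<sigma>))\<^sup>2 = real n powr (- (2 * \<sigma>))" for n
    by (simp add: power2_eq_square powr_add[symmetric])
  then show ?thesis using assms by (simp add: summable_real_powr_iff)
qed

lemma summable_square_ln_nat_powr:
  assumes "1/2 < \<sigma>"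
  shows "summable (\<lambda>n. (ln (real n) * real n powr (- \<sigma>))\<^sup>2)"
proof (rule summable_comparison_test'[where N = 1])
  \<comment> \<open>Half of the margin of \<sigma> over 1/2 pays for the logarithm through ln n
    \<le> n^\<delta> / \<delta>; the other half keeps the sum convergent.\<close>
  define \<delta> where "\<delta> = (\<sigma> - 1/2) / 2"
  have \<delta>: "0 < \<delta>" "1/2 < \<sigma> - \<delta>" using assms by (simp_all add: \<delta>_def field_simps)
  show "summable (\<lambda>n. (1 / \<delta>)\<^sup>2 * (real n powr (- (\<sigma> - \<delta>)))\<^sup>2)"
    by (intro summable_mult summable_square_nat_powr \<delta>)
  fix n :: nat assume n: "1 \<le> n"
  have "ln (real n) * real n powr (- \<sigma>) \<le> real n powr \<delta> / \<delta> * real n powr (- \<sigma>)"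
    using n \<delta> by (intro mult_right_mono ln_powr_bound) auto
  also have "\<dots> = 1 / \<delta> * real n powr (- (\<sigma> - \<delta>))"
    by (simp add: powr_add[symmetric])
  finally have "(ln (real n) * real n powr (- \<sigma>))\<^sup>2 \<le> (1 / \<delta> * real n powr (- (\<sigma> - \<delta>)))\<^sup>2"
    using n by (intro power_mono) auto
  then show "norm ((ln (real n) * real n powr (- \<sigma>))\<^sup>2) \<le> (1 / \<delta>)\<^sup>2 * (real n powr (- (\<sigma> - \<delta>)))\<^sup>2"
    by (simp add: power_mult_distrib power_divide)
qed

lemma H2_summable:
  assumes "a \<in> H2" "1/2 < \<sigma>"
  shows "summable (\<lambda>n. cmod (a n) * real n powr (- \<sigma>))"
  using Cauchy_Schwarz_suminf(1)[OF H2_partial_sum_le[OF assms(1)] H2_norm_nonneg[OF assms(1)] summable_square_nat_powr[OF assms(2)]]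
  by simp

lemma abs_ln_nat: "\<bar>ln (real n)\<bar> = ln (real n)"
  by (cases "n = 0") auto

lemma H2_ln_summable:
  assumes "a \<in> H2" "1/2 < \<sigma>"
  shows "summable (\<lambda>n. cmod (a n) * (ln (real n) * real n powr (- \<sigma>)))"
    and "(\<Sum>n. cmod (a n) * (ln (real n) * real n powr (- \<sigma>)))
      \<le> H2_norm a * sqrt (\<Sum>n. (ln (real n) * real n powr (- \<sigma>))\<^sup>2)"
  using Cauchy_Schwarz_suminf[OF H2_partial_sum_le[OF assms(1)] H2_norm_nonneg[OF assms(1)] summable_square_ln_nat_powr[OF assms(2)]]
  by (simp_all add: abs_mult abs_ln_nat)

lemma norm_dirichlet_term_le:
  "\<sigma> \<le> Re s \<Longrightarrow> cmod (a * of_nat n powr (- s)) \<le> cmod a * real n powr (- \<sigma>)"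
  by (auto simp: norm_mult norm_nat_powr intro!: mult_left_mono nat_powr_mono)

lemma norm_dirichlet_deriv_term_le:
  "\<sigma> \<le> Re s \<Longrightarrow> cmod (a * - (of_real (ln (real n)) * of_nat n powr (- s)))
    \<le> cmod a * (ln (real n) * real n powr (- \<sigma>))"
  using abs_ge_zero[of "ln (real n)"]
  by (auto simp: norm_mult norm_nat_powr abs_ln_nat intro!: mult_left_mono nat_powr_mono)

lemma H2_sums_dir_eval:
  assumes "a \<in> H2" "s \<in> halfplane (1/2)"
  shows "(\<lambda>n. a n * of_nat n powr (- s)) sums dir_eval a s"
proof -
  have "summable (\<lambda>n. a n * of_nat n powr (- s))"
    by (rule summable_comparison_test'[OF H2_summable[OF assms(1), of "Re s"]])
       (use assms(2) in \<open>auto simp: halfplane_def intro: norm_dirichlet_term_le\<close>)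
  then show ?thesis unfolding dir_eval_def by (rule summable_sums)
qed

lemma DERIV_dir_eval:
  assumes a: "a \<in> H2" and s: "s \<in> halfplane (1/2)"
  shows "(dir_eval a has_field_derivative (\<Sum>n. a n * - (of_real (ln (real n)) * of_nat n powr (- s)))) (at s)"
proof -
  \<comment> \<open>Uniform convergence is at hand only on half-planes strictly inside Re s > 1/2,
    so \<sigma> is the midpoint of 1/2 and Re s.\<close>
  define \<sigma> where "\<sigma> = (1/2 + Re s) / 2"
  have \<sigma>: "1/2 < \<sigma>" "\<sigma> < Re s" using s by (auto simp: \<sigma>_def halfplane_def field_simps)
  have "((\<lambda>s. \<Sum>n. a n * of_nat n powr (- s)) has_field_derivative
      (\<Sum>n. a n * - (of_real (ln (real n)) * of_nat n powr (- s)))) (at s)"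
  proof (rule has_field_derivative_series'(2)[where S = "halfplane \<sigma>" and x0 = s])
    show "uniformly_convergent_on (halfplane \<sigma>) (\<lambda>n z. \<Sum>i<n. a i * - (of_real (ln (real i)) * of_nat i powr (- z)))"
      by (rule Weierstrass_m_test'[OF _ H2_ln_summable(1)[OF a \<sigma>(1)]])
         (rule norm_dirichlet_deriv_term_le, simp add: halfplane_def)
    show "summable (\<lambda>n. a n * of_nat n powr (- s))"
      using H2_sums_dir_eval[OF a s] by (rule sums_summable)
    show "s \<in> interior (halfplane \<sigma>)" "s \<in> halfplane \<sigma>"
      using \<sigma> by (auto simp: interior_open[OF open_halfplane], auto simp: halfplane_def)
  qed (rule convex_halfplane DERIV_cmult has_field_derivative_nat_powr)+
  then show ?thesis by (simp add: dir_eval_def[abs_def])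
qed

lemma deriv_dir_eval:
  "a \<in> H2 \<Longrightarrow> s \<in> halfplane (1/2) \<Longrightarrow>
    deriv (dir_eval a) s = (\<Sum>n. a n * - (of_real (ln (real n)) * of_nat n powr (- s)))"
  by (rule DERIV_imp_deriv[OF DERIV_dir_eval])

lemma holomorphic_dir_eval: "a \<in> H2 \<Longrightarrow> dir_eval a holomorphic_on halfplane (1/2)"
  by (auto simp: holomorphic_on_open[OF open_halfplane] intro: DERIV_dir_eval)

lemma H2_summable_deriv:
  assumes "a \<in> H2" "s \<in> halfplane (1/2)"
  shows "summable (\<lambda>n. a n * - (of_real (ln (real n)) * of_nat n powr (- s)))"
proof (rule summable_comparison_test'[where N = 0])
  show "summable (\<lambda>n. cmod (a n) * (ln (real n) * real n powr (- Re s)))"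
    using assms by (intro H2_ln_summable) (simp_all add: halfplane_def)
qed (rule norm_dirichlet_deriv_term_le, simp)

text \<open>Cauchy-Schwarz. The square root is the norm of the functional f -> f'(\<sigma>), so a
  single constant serves the whole closed half-plane Re s \<ge> \<sigma>.\<close>

lemma norm_deriv_dir_eval_le:
  assumes a: "a \<in> H2" and \<sigma>: "1/2 < \<sigma>" "\<sigma> \<le> Re s"
  shows "cmod (deriv (dir_eval a) s) \<le> H2_norm a * sqrt (\<Sum>n. (ln (real n) * real n powr (- \<sigma>))\<^sup>2)"
proof -
  let ?t = "\<lambda>n. a n * - (complex_of_real (ln (real n)) * of_nat n powr (- s))"
  have "s \<in> halfplane (1/2)" using \<sigma> by (simp add: halfplane_def)
  moreover have "norm (\<Sum>n. ?t n) \<le> (\<Sum>n. cmod (a n) * (ln (real n) * real n powr (- \<sigma>)))"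
  proof (rule order_trans[OF summable_norm suminf_le])
    show "cmod (?t n) \<le> cmod (a n) * (ln (real n) * real n powr (- \<sigma>))" for n
      using \<sigma>(2) by (rule norm_dirichlet_deriv_term_le)
    then show "summable (\<lambda>n. cmod (?t n))" "summable (\<lambda>n. cmod (?t n))"
      by (auto intro: summable_comparison_test'[OF H2_ln_summable(1)[OF a \<sigma>(1)], of 0])
  qed (rule H2_ln_summable(1)[OF a \<sigma>(1)])
  ultimately have "cmod (deriv (dir_eval a) s) \<le> (\<Sum>n. cmod (a n) * (ln (real n) * real n powr (- \<sigma>)))"
    by (simp only: deriv_dir_eval[OF a])
  also note H2_ln_summable(2)[OF a \<sigma>(1)]
  finally show ?thesis .
qed

lemma deriv_dir_eval_lincomb:
  assumes "a \<in> H2" "b \<in> H2" "s \<in> halfplane (1/2)"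
  shows "deriv (dir_eval (\<lambda>m. x * a m + y * b m)) s = x * deriv (dir_eval a) s + y * deriv (dir_eval b) s"
proof -
  let ?l = "\<lambda>n. - (complex_of_real (ln (real n)) * of_nat n powr (- s))"
  have "(\<lambda>n. x * (a n * ?l n) + y * (b n * ?l n)) sums (x * (\<Sum>n. a n * ?l n) + y * (\<Sum>n. b n * ?l n))"
    by (intro sums_add sums_mult summable_sums H2_summable_deriv assms)
  then show ?thesis
    unfolding deriv_dir_eval[OF H2_lincomb[OF assms(1,2)] assms(3)] deriv_dir_eval[OF assms(1,3)] deriv_dir_eval[OF assms(2,3)]
    by (simp only: ring_distribs mult.assoc sums_iff)
qed

text \<open>On Re s = 1 the partial sums converge uniformly to 0. Their means against m^s equal b m
  from some index on, and must tend to the mean of 0.\<close>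

lemma H2_zero_unique:
  assumes b: "b \<in> H2" and zero: "\<And>s. s \<in> halfplane (1/2) \<Longrightarrow> (\<lambda>m. b m * of_nat m powr (- s)) sums 0"
  shows "b = (\<lambda>_. 0)"
proof
  fix m
  show "b m = 0"
  proof (cases "m = 0")
    case True
    then show ?thesis using b by (simp add: H2_def)
  next
    case False
    define f where "f j t = (\<Sum>n<j. b n * of_nat n powr (- Complex 1 t)) * of_nat m powr Complex 1 t" for j t
    have mean: "has_mean (f j) (if m < j then b m else 0)" for j
      unfolding f_def using False by (intro has_mean_dirichlet_polynomial) auto
    have ul: "uniform_limit UNIV (\<lambda>j t. \<Sum>n<j. b n * of_nat n powr (- Complex 1 t))
        (\<lambda>t. \<Sum>n. b n * of_nat n powr (- Complex 1 t)) sequentially"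
      by (rule Weierstrass_m_test[OF norm_dirichlet_term_le H2_summable[OF b, of 1]]) auto
    have "Complex 1 t \<in> halfplane (1/2)" for t by (simp add: halfplane_def)
    then have "(\<Sum>n. b n * of_nat n powr (- Complex 1 t)) = 0" for t
      using sums_unique[OF zero] by metis
    with ul have ul: "uniform_limit UNIV (\<lambda>j t. \<Sum>n<j. b n * of_nat n powr (- Complex 1 t)) (\<lambda>t. 0) sequentially"
      by simp
    have ulf: "uniform_limit UNIV f (\<lambda>t. 0) sequentially"
    proof (rule uniform_limitI)
      fix e :: real assume "0 < e"
      then have "\<forall>\<^sub>F j in sequentially. \<forall>t\<in>UNIV. dist (\<Sum>n<j. b n * of_nat n powr (- Complex 1 t)) 0 < e / real m"
        using False by (intro uniform_limitD[OF ul]) auto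
      then show "\<forall>\<^sub>F j in sequentially. \<forall>t\<in>UNIV. dist (f j t) 0 < e"
        by eventually_elim (use False in \<open>auto simp: f_def norm_mult norm_nat_powr field_simps\<close>)
    qed
    obtain l where l: "(\<lambda>j. if m < j then b m else 0) \<longlonglongrightarrow> l" "has_mean (\<lambda>t. 0) l"
      using has_mean_uniform_limit[where f = f, OF mean ulf continuous_on_const] by blast
    have "l = 0" using has_mean_unique[OF l(2) has_mean_const] .
    moreover have "(\<lambda>j. if m < j then b m else 0) \<longlonglongrightarrow> b m"
      by (intro tendsto_eventually eventually_mono[OF eventually_gt_at_top[of m]]) simp
    ultimately show ?thesis using LIMSEQ_unique[OF l(1)] by simp
  qed
qed

text \<open>The abscissa \<sigma> may be arbitrarily large: it only decides where the coefficients
  are read off and does not enter the norm bound, which depends on the supremum over Re s > 0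
  alone.\<close>

theorem bounded_dirichlet_approximable_H2:
  assumes holo: "F holomorphic_on halfplane 0"
    and bound: "\<And>s. s \<in> halfplane 0 \<Longrightarrow> cmod (F s) \<le> M"
    and approx: "dirichlet_approximable \<sigma> F"
  obtains b where "b \<in> H2" "H2_norm b \<le> M"
    "\<And>s. s \<in> halfplane (1/2) \<Longrightarrow> (\<lambda>m. b m * of_nat m powr (- s)) sums F s"
proof -
  have "cmod (F 1) \<le> M" by (rule bound) (simp add: halfplane_def)
  then have M: "0 \<le> M" using norm_ge_zero order_trans by blast
  \<comment> \<open>The line must lie in the half-plane of approximation, where the coefficients are
    found, and in Re s > 0, where \<open>has_mean_shift\<close> can move them.\<close>
  define \<tau> where "\<tau> = max \<sigma> 0 + 1"
  have \<tau>: "max \<sigma> 0 < \<tau>" "0 < \<tau>" by (auto simp: \<tau>_def)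
  have approx': "dirichlet_approximable (max \<sigma> 0) F"
    using approx by (rule dirichlet_approximable_mono) simp
  have "continuous_on (halfplane (max \<sigma> 0)) F"
    using holomorphic_on_imp_continuous_on[OF holo] by (rule continuous_on_subset) (auto simp: halfplane_def)
  from dirichlet_approximable_series[OF approx' this \<tau>(1)] obtain b where b: "b 0 = 0"
    "\<And>m. 0 < m \<Longrightarrow> has_mean (\<lambda>t. F (Complex \<tau> t) * of_nat m powr Complex \<tau> t) (b m)"
    "\<And>s. s \<in> halfplane (\<tau> + 1/2) \<Longrightarrow> (\<lambda>m. b m * of_nat m powr (- s)) sums F s"
    by blast
  have Bessel: "(\<Sum>m<K. (cmod (b m) * real m powr (- x))\<^sup>2) \<le> M\<^sup>2" if "0 < x" for x K
  proof (rule mean_Bessel_vertical)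
    show "cmod (F (Complex x t)) \<le> M" for t
      using that by (intro bound) (simp add: halfplane_def)
    show "has_mean (\<lambda>t. F (Complex x t) * of_nat m powr Complex x t) (b m)" if "0 < m" for m
      by (rule has_mean_shift[OF holo bound \<tau>(2) \<open>0 < x\<close> b(2)[OF that]])
  qed (rule b(1))
  \<comment> \<open>K stays fixed while x tends to 0, so the limit passes through a finite
    sum.\<close>
  have "(\<Sum>m<K. (cmod (b m))\<^sup>2) \<le> M\<^sup>2" for K
  proof -
    have "((\<lambda>x. \<Sum>m<K. (cmod (b m) * real m powr (- x))\<^sup>2) \<longlongrightarrow> (\<Sum>m<K. (cmod (b m))\<^sup>2)) (at_right 0)"
    proof (rule tendsto_sum)
      fix m
      show "((\<lambda>x. (cmod (b m) * real m powr (- x))\<^sup>2) \<longlongrightarrow> (cmod (b m))\<^sup>2) (at_right 0)"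
      proof (cases "m = 0")
        case False
        then have "((\<lambda>x. (cmod (b m) * real m powr (- x))\<^sup>2) \<longlongrightarrow> (cmod (b m) * real m powr (- 0))\<^sup>2) (at_right 0)"
          by (intro tendsto_intros) auto
        then show ?thesis using False by simp
      qed (simp add: b)
    qed
    then show ?thesis
      by (rule tendsto_upperbound[OF _ eventually_mono[OF eventually_at_right_less Bessel]]) simp_all
  qed
  note b_H2 = H2I[OF b(1) M this]
  have eq: "dir_eval b s = F s" if "s \<in> halfplane (1/2)" for s
  proof (rule analytic_continuation_open[where s = "halfplane (\<tau> + 1/2)" and s' = "halfplane (1/2)" and f = "dir_eval b" and g = F])
    show "halfplane (\<tau> + 1/2) \<noteq> {}"
      by (auto simp: halfplane_def intro!: exI[of _ "of_real (\<tau> + 1)"])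
    show "connected (halfplane (1/2))" by (intro convex_connected convex_halfplane)
    show "dir_eval b z = F z" if "z \<in> halfplane (\<tau> + 1/2)" for z
      using sums_unique[OF b(3)[OF that]] by (simp add: dir_eval_def)
    show "F holomorphic_on halfplane (1/2)"
      by (rule holomorphic_on_subset[OF holo]) (auto simp: halfplane_def)
  qed (use that \<tau> in \<open>auto simp: open_halfplane holomorphic_dir_eval b_H2(1), auto simp: halfplane_def\<close>)
  show ?thesis
    by (rule that[OF b_H2]) (use H2_sums_dir_eval[OF b_H2(1)] eq in fastforce)
qed

section \<open>The composition-differentiation operator\<close>

lemma dirichlet_polynomial_partial_sum: "dirichlet_polynomial (\<lambda>s. \<Sum>n<N. c n * of_nat n powr (- s))"
  unfolding dirichlet_polynomial_def by blast

text \<open>Convergence at the single point \<theta> + 1 bounds the terms there; moving two further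
  units to the right gains the summable factor n^(-2). Hence the 3.\<close>

lemma convergent_dirichlet_series_approximable:
  assumes "\<And>s. s \<in> halfplane \<theta> \<Longrightarrow> (\<lambda>n. c n * of_nat n powr (- s)) sums \<phi> s"
  shows "dirichlet_approximable (\<theta> + 3) \<phi>"
  unfolding dirichlet_approximable_def
proof (intro allI impI)
  fix e :: real assume e: "0 < e"
  have "(\<lambda>n. c n * of_nat n powr (- of_real (\<theta> + 1))) sums \<phi> (of_real (\<theta> + 1))"
    by (rule assms) (simp add: halfplane_def)
  then have "Bseq (\<lambda>n. c n * of_nat n powr (- of_real (\<theta> + 1)))"
    by (intro convergent_imp_Bseq convergentI[OF summable_LIMSEQ_zero] sums_summable)
  then obtain A where A: "\<And>n. cmod (c n * of_nat n powr (- of_real (\<theta> + 1))) \<le> A"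
    unfolding Bseq_def by blast
  have A: "cmod (c n) * real n powr (- (\<theta> + 1)) \<le> A" for n
    using A[of n] by (simp add: norm_mult norm_nat_powr)
  have "uniform_limit (halfplane (\<theta> + 3)) (\<lambda>N s. \<Sum>n<N. c n * of_nat n powr (- s))
      (\<lambda>s. \<Sum>n. c n * of_nat n powr (- s)) sequentially"
  proof (rule Weierstrass_m_test)
    show "summable (\<lambda>n. A * real n powr (- 2))"
      by (intro summable_mult) (simp add: summable_real_powr_iff)
    show "cmod (c n * of_nat n powr (- s)) \<le> A * real n powr (- 2)" if "s \<in> halfplane (\<theta> + 3)" for n s
    proof -
      have "cmod (c n * of_nat n powr (- s)) \<le> cmod (c n) * real n powr (- (\<theta> + 3))"
        using that by (intro norm_dirichlet_term_le) (simp add: halfplane_def)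
      also have "\<dots> = (cmod (c n) * real n powr (- (\<theta> + 1))) * real n powr (- 2)"
        by (simp add: powr_add[symmetric] algebra_simps)
      also have "\<dots> \<le> A * real n powr (- 2)"
        by (intro mult_right_mono A) simp
      finally show ?thesis .
    qed
  qed
  from uniform_limitD[OF this e]
  obtain N where N: "\<And>s. s \<in> halfplane (\<theta> + 3) \<Longrightarrow>
      dist (\<Sum>n<N. c n * of_nat n powr (- s)) (\<Sum>n. c n * of_nat n powr (- s)) < e"
    by (auto simp: eventually_sequentially)
  have "cmod (\<phi> s - (\<Sum>n<N. c n * of_nat n powr (- s))) < e" if "s \<in> halfplane (\<theta> + 3)" for s
  proof -
    have "s \<in> halfplane \<theta>" using that by (simp add: halfplane_def)
    from sums_unique[OF assms[OF this]] N[OF that] show ?thesis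
      by (simp add: dist_norm norm_minus_commute)
  qed
  then show "\<exists>P. dirichlet_polynomial P \<and> (\<forall>s\<in>halfplane (\<theta> + 3). cmod (\<phi> s - P s) < e)"
    using dirichlet_polynomial_partial_sum by blast
qed

text \<open>Because c0 is a natural number, so is n ^ c0, and the linear part of the symbol
  contributes one Dirichlet monomial. The other factor is exp of an approximable function.\<close>

lemma nat_powr_symbol_approximable:
  assumes "dirichlet_approximable \<sigma> (\<lambda>s. \<Phi> s - of_nat c0 * s)"
  shows "dirichlet_approximable \<sigma> (\<lambda>s. of_nat n powr (- \<Phi> s))"
proof (cases "n = 0")
  case True
  then show ?thesis by (simp add: dirichlet_approximable_const)
next
  case False
  have "of_nat n powr (- \<Phi> s) = 1 * of_nat (n ^ c0) powr (- s)
      * exp ((- of_real (ln (real n))) * (\<Phi> s - of_nat c0 * s))" for s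
    using False Ln_of_nat[of "n ^ c0"]
    by (simp add: powr_def Ln_of_nat ln_realpow exp_add[symmetric] algebra_simps)
  then show ?thesis
    by (simp only:) (intro dirichlet_approximable_mult dirichlet_approximable_exp dirichlet_approximable_const
        dirichlet_approximable_polynomial[OF dirichlet_polynomial_monomial] assms)
qed

text \<open>The series of f' converges uniformly on Re z > \<epsilon>, and \<Phi> takes its values
  there, so truncation is uniform in s. The condition 0 \<le> \<sigma> keeps s where the range of
  \<Phi> is controlled.\<close>

lemma deriv_dir_eval_comp_approximable:
  assumes a: "a \<in> H2" and \<sigma>: "0 \<le> \<sigma>" "1/2 < \<epsilon>"
    and maps: "\<Phi> ` halfplane 0 \<subseteq> halfplane \<epsilon>"
    and symbol: "dirichlet_approximable \<sigma> (\<lambda>s. \<Phi> s - of_nat c0 * s)"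
  shows "dirichlet_approximable \<sigma> (\<lambda>s. deriv (dir_eval a) (\<Phi> s))"
proof (rule dirichlet_approximable_limit)
  fix e :: real assume e: "0 < e"
  let ?t = "\<lambda>n z. a n * - (of_real (ln (real n)) * of_nat n powr (- z))"
  have "uniform_limit (halfplane \<epsilon>) (\<lambda>N z. \<Sum>n<N. ?t n z) (\<lambda>z. \<Sum>n. ?t n z) sequentially"
    by (rule Weierstrass_m_test[OF norm_dirichlet_deriv_term_le H2_ln_summable(1)[OF a \<sigma>(2)]])
       (auto simp: halfplane_def)
  from uniform_limitD[OF this e]
  obtain N where N: "\<And>z. z \<in> halfplane \<epsilon> \<Longrightarrow> dist (\<Sum>n<N. ?t n z) (\<Sum>n. ?t n z) < e"
    by (auto simp: eventually_sequentially)
  have "cmod (deriv (dir_eval a) (\<Phi> s) - (\<Sum>n<N. ?t n (\<Phi> s))) < e" if "s \<in> halfplane \<sigma>" for s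
  proof -
    have "s \<in> halfplane 0" using that \<sigma> by (simp add: halfplane_def)
    then have "\<Phi> s \<in> halfplane \<epsilon>" using maps by blast
    moreover from this have "\<Phi> s \<in> halfplane (1/2)" using \<sigma> by (simp add: halfplane_def)
    ultimately show ?thesis
      using N by (simp only: deriv_dir_eval[OF a]) (simp add: dist_norm norm_minus_commute)
  qed
  moreover have "dirichlet_approximable \<sigma> (\<lambda>s. \<Sum>n<N. (- a n * of_real (ln (real n))) * of_nat n powr (- \<Phi> s))"
    by (intro dirichlet_approximable_sum dirichlet_approximable_mult dirichlet_approximable_const
        nat_powr_symbol_approximable[OF symbol])
  ultimately show "\<exists>G. dirichlet_approximable \<sigma> G \<and> (\<forall>s\<in>halfplane \<sigma>. cmod (deriv (dir_eval a) (\<Phi> s) - G s) < e)"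
    by (intro exI[of _ "\<lambda>s. \<Sum>n<N. (- a n * of_real (ln (real n))) * of_nat n powr (- \<Phi> s)"])
       (simp add: mult.assoc)
qed

lemma comp_diff_rel_unique:
  assumes "comp_diff_rel \<Phi> a b" "comp_diff_rel \<Phi> a b'"
  shows "b = b'"
proof -
  have b: "b \<in> H2" "b' \<in> H2"
    using assms by (auto simp: comp_diff_rel_def)
  have "(\<lambda>m. 1 * b m + (- 1) * b' m) = (\<lambda>_. 0)"
  proof (rule H2_zero_unique[OF H2_lincomb[OF b]])
    fix s assume "s \<in> halfplane (1/2)"
    then have "(\<lambda>m. b m * of_nat m powr (- s) - b' m * of_nat m powr (- s)) sums
        (deriv (dir_eval a) (\<Phi> s) - deriv (dir_eval a) (\<Phi> s))"
      using assms by (intro sums_diff) (auto simp: comp_diff_rel_def)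
    then show "(\<lambda>m. (1 * b m + (- 1) * b' m) * of_nat m powr (- s)) sums 0"
      by (simp add: left_diff_distrib)
  qed
  then show ?thesis by (auto simp: fun_eq_iff)
qed

text \<open>Replaces the definite description: by uniqueness, any witness of the relation is the
  value of the operator.\<close>

lemma comp_diff_eqI: "comp_diff_rel \<Phi> a b \<Longrightarrow> comp_diff \<Phi> a = b"
  unfolding comp_diff_def by (blast intro: the_equality comp_diff_rel_unique)

lemma e_basis_H2: "0 < n \<Longrightarrow> e_basis n \<in> H2"
  by (auto simp: H2_def e_basis_def intro!: summable_finite[of "{n}"] split: if_splits)

lemma deriv_dir_eval_e_basis:
  assumes "0 < n" "s \<in> halfplane (1/2)"
  shows "deriv (dir_eval (e_basis n)) s = - (of_real (ln (real n)) * of_nat n powr (- s))"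
  unfolding deriv_dir_eval[OF e_basis_H2[OF assms(1)] assms(2)]
  by (subst suminf_finite[of "{n}"]) (auto simp: e_basis_def)

theorem theorem4p3:
  fixes \<Phi> :: "complex \<Rightarrow> complex" and c0 :: nat and c :: "nat \<Rightarrow> complex"
    and \<theta> :: real and \<epsilon> :: real
  assumes holo: "\<Phi> holomorphic_on halfplane 0"
    and symbol: "\<forall>s \<in> halfplane \<theta>.
        ((\<lambda>n. c n * of_nat n powr (- s)) sums (\<Phi> s - of_nat c0 * s))"
    and eps: "\<epsilon> > 1/2"
    and maps: "\<Phi> ` halfplane 0 \<subseteq> halfplane \<epsilon>"
  shows "comp_diff_well_defined \<Phi> \<and> hilbert_schmidt_H2 (comp_diff \<Phi>)"
proof -
  \<comment> \<open>\<theta> may be negative; the maximum with 0 stays inside the half-plane where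
    \<Phi> is holomorphic.\<close>
  define \<sigma> where "\<sigma> = max (\<theta> + 3) 0"
  have \<phi>: "dirichlet_approximable \<sigma> (\<lambda>s. \<Phi> s - of_nat c0 * s)"
  proof (rule dirichlet_approximable_mono)
    show "dirichlet_approximable (\<theta> + 3) (\<lambda>s. \<Phi> s - of_nat c0 * s)"
      using symbol by (intro convergent_dirichlet_series_approximable) auto
  qed (simp add: \<sigma>_def)
  have Re_\<Phi>: "\<epsilon> \<le> Re (\<Phi> s)" "\<Phi> s \<in> halfplane (1/2)" if "s \<in> halfplane 0" for s
  proof -
    have "\<Phi> s \<in> halfplane \<epsilon>" using that maps by blast
    then show "\<epsilon> \<le> Re (\<Phi> s)" "\<Phi> s \<in> halfplane (1/2)"
      using eps by (simp_all add: halfplane_def)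
  qed
  \<comment> \<open>M is left free: the operator bound takes it from Cauchy-Schwarz, the basis
    vectors from a direct estimate that decays in n.\<close>
  have ex: "\<exists>b. comp_diff_rel \<Phi> a b \<and> H2_norm b \<le> M"
    if a: "a \<in> H2" and M: "\<And>s. s \<in> halfplane 0 \<Longrightarrow> cmod (deriv (dir_eval a) (\<Phi> s)) \<le> M" for a M
  proof -
    have "deriv (dir_eval a) holomorphic_on halfplane (1/2)"
      by (intro holomorphic_deriv holomorphic_dir_eval a open_halfplane)
    then have "deriv (dir_eval a) \<circ> \<Phi> holomorphic_on halfplane 0"
      using Re_\<Phi> by (intro holomorphic_on_compose_gen[OF holo]) auto
    moreover have "dirichlet_approximable \<sigma> (\<lambda>s. deriv (dir_eval a) (\<Phi> s))"
      by (rule deriv_dir_eval_comp_approximable[OF a _ eps maps \<phi>]) (simp add: \<sigma>_def)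
    ultimately obtain b where "b \<in> H2" "H2_norm b \<le> M"
      "\<And>s. s \<in> halfplane (1/2) \<Longrightarrow> (\<lambda>m. b m * of_nat m powr (- s)) sums deriv (dir_eval a) (\<Phi> s)"
      using bounded_dirichlet_approximable_H2[where F = "\<lambda>s. deriv (dir_eval a) (\<Phi> s)", OF _ M] by (auto simp: o_def)
    then show ?thesis by (auto simp: comp_diff_rel_def)
  qed
  define K where "K = sqrt (\<Sum>n. (ln (real n) * real n powr (- \<epsilon>))\<^sup>2)"
  have ex_K: "\<exists>b. comp_diff_rel \<Phi> a b \<and> H2_norm b \<le> H2_norm a * K" if "a \<in> H2" for a
    unfolding K_def by (intro ex norm_deriv_dir_eval_le that eps Re_\<Phi>)
  have rel: "comp_diff_rel \<Phi> a (comp_diff \<Phi> a)" if "a \<in> H2" for a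
    using ex_K[OF that] comp_diff_eqI by auto
  have norm_le: "H2_norm (comp_diff \<Phi> a) \<le> M"
    if "a \<in> H2" "\<And>s. s \<in> halfplane 0 \<Longrightarrow> cmod (deriv (dir_eval a) (\<Phi> s)) \<le> M" for a M
    using ex[OF that] comp_diff_eqI by auto
  have "comp_diff_well_defined \<Phi>"
    unfolding comp_diff_well_defined_def using rel comp_diff_rel_unique by blast
  moreover have "hilbert_schmidt_H2 (comp_diff \<Phi>)"
    unfolding hilbert_schmidt_H2_def
  proof (intro conjI ballI allI)
    show T: "comp_diff \<Phi> a \<in> H2" if "a \<in> H2" for a
      using rel[OF that] by (simp add: comp_diff_rel_def)
    show "comp_diff \<Phi> (\<lambda>m. x * a m + y * b m) = (\<lambda>m. x * comp_diff \<Phi> a m + y * comp_diff \<Phi> b m)"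
      if ab: "a \<in> H2" "b \<in> H2" for a b x y
    proof (rule comp_diff_eqI)
      have "(\<lambda>m. (x * comp_diff \<Phi> a m + y * comp_diff \<Phi> b m) * of_nat m powr (- s))
          sums deriv (dir_eval (\<lambda>m. x * a m + y * b m)) (\<Phi> s)" if s: "s \<in> halfplane (1/2)" for s
      proof -
        have "(\<lambda>m. x * (comp_diff \<Phi> a m * of_nat m powr (- s)) + y * (comp_diff \<Phi> b m * of_nat m powr (- s)))
          sums (x * deriv (dir_eval a) (\<Phi> s) + y * deriv (dir_eval b) (\<Phi> s))"
          using rel[OF ab(1)] rel[OF ab(2)] s by (intro sums_add sums_mult) (auto simp: comp_diff_rel_def)
        moreover have "\<Phi> s \<in> halfplane (1/2)"
          using s by (intro Re_\<Phi>) (simp add: halfplane_def)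
        ultimately show ?thesis
          by (simp add: deriv_dir_eval_lincomb[OF ab] algebra_simps)
      qed
      then show "comp_diff_rel \<Phi> (\<lambda>m. x * a m + y * b m) (\<lambda>m. x * comp_diff \<Phi> a m + y * comp_diff \<Phi> b m)"
        using H2_lincomb[OF T[OF ab(1)] T[OF ab(2)]] by (simp add: comp_diff_rel_def)
    qed
    show "\<exists>C. \<forall>a\<in>H2. H2_norm (comp_diff \<Phi> a) \<le> C * H2_norm a"
      using ex_K comp_diff_eqI by (intro exI[of _ K]) (auto simp: mult.commute)
    \<comment> \<open>The orthonormal basis starts at n = 1, hence the shift by
      \<open>Suc\<close>.\<close>
    have "summable (\<lambda>n. (ln (real (Suc n)) * real (Suc n) powr (- \<epsilon>))\<^sup>2)"
      using summable_square_ln_nat_powr[OF eps] by (subst summable_Suc_iff)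
    then show "summable (\<lambda>n. (H2_norm (comp_diff \<Phi> (e_basis (Suc n))))\<^sup>2)"
    proof (rule summable_comparison_test'[where N = 0])
      fix n
      \<comment> \<open>Every basis vector has norm 1, so the operator bound would give only the
        constant K. The derivative of n^(-s) is a single term, and its supremum is square summable
        in n.\<close>
      have "H2_norm (comp_diff \<Phi> (e_basis (Suc n))) \<le> ln (real (Suc n)) * real (Suc n) powr (- \<epsilon>)"
      proof (rule norm_le[OF e_basis_H2])
        fix s assume s: "s \<in> halfplane 0"
        have "real (Suc n) powr (- Re (\<Phi> s)) \<le> real (Suc n) powr (- \<epsilon>)"
          using Re_\<Phi>(1)[OF s] by (intro nat_powr_mono) simp
        then show "cmod (deriv (dir_eval (e_basis (Suc n))) (\<Phi> s)) \<le> ln (real (Suc n)) * real (Suc n) powr (- \<epsilon>)"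
          by (simp add: deriv_dir_eval_e_basis[OF _ Re_\<Phi>(2)[OF s]] norm_mult norm_nat_powr mult_left_mono
              del: of_nat_Suc)
      qed simp
      then show "norm ((H2_norm (comp_diff \<Phi> (e_basis (Suc n))))\<^sup>2) \<le> (ln (real (Suc n)) * real (Suc n) powr (- \<epsilon>))\<^sup>2"
        using H2_norm_nonneg[OF T[OF e_basis_H2]] by (simp add: power_mono)
    qed
  qed
  ultimately show ?thesis by blast
qed

end
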